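(* Let $\Gamma=(V,E)$ be an unbalanced distance-biregular graph with diameter $d=2r+2$ and girth deficiency two. Let $\mathcal R$ be the set consisting of the diagonal relation $1_E=\{(e,e):e\in E\}$ and the relations $R^{\uparrow}_i$ and $R^{\downarrow}_i$, $i=0,\ldots,d-2$, on $E$ defined in the context. Let $\mathcal A_d(k,l)$ be the complex linear span in $\mathrm{Mat}_E(\mathbb C)$ of the adjacency matrices of the relations in $\mathcal R$. Then $(E,\mathcal R)$ is an association scheme, and $\mathcal A_d(k,l)$ is its adjacency algebra and has dimension $2d-1$.
   Context: All graphs are finite, undirected and simple. For a connected graph $\Gamma$ and a vertex $u$, $\Gamma_i(u)$ is the set of vertices at distance $i$ from $u$, and $\varepsilon(u)$ is the eccentricity of $u$. A connected bipartite graph with bipartition classes $A$, $B$ is distance-biregular if, for every vertex $u$, every $0\le i\le\varepsilon(u)$ and every $v\in\Gamma_i(u)$, the numbers $|\Gamma_{i+1}(u)\cap\Gamma_1(v)|$ and $|\Gamma_{i-1}(u)\cap\Gamma_1(v)|$ depend only on $i$ and on the class containing $u$. All vertices of $A$ (resp. $B$) then have the same eccentricity $d_A$ (resp. $d_B$). The graph is unbalanced if $d_A\ne d_B$; it has girth deficiency two if its girth is $2d-2$, where $d$ is the diameter. In the unbalanced case the classes are labelled so that $d=d_A>d_B$; it is known that then $d$ is even, and we write $d=2r+2$ ($r\ge1$). The degree of the vertices of $A$ is $k+1$ and the degree of the vertices of $B$ is $l+1$. Relations on $E$: for an ordered pair of distinct edges, the first edge is written $uv$ with $u\in A$, $v\in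 B$, and the second edge is written $u'v'$ with $d(u',u)<d(v',u)$ (so $u'$ may lie in $A$ or in $B$). Put $D^i_j(u,v)=\Gamma_i(u)\cap\Gamma_j(v)$. For $i=0,\ldots,d-2$: $(uv,u'v')\in R^{\uparrow}_i$ if and only if $u'\in D^i_{i+1}(u,v)$; and $(uv,u'v')\in R^{\downarrow}_i$ if and only if $u'\in D^{i+1}_i(u,v)$. $\mathrm{Mat}_E(\mathbb C)$ is the algebra of complex matrices with rows and columns indexed by $E$. The adjacency matrix of a relation $s\subseteq E\times E$ is the $\{0,1\}$-matrix with $(x,y)$-entry $1$ iff $(x,y)\in s$. An association scheme on a finite set $\Omega$ is a pair $(\Omega,\mathcal R)$ where $\mathcal R$ is a partition of $\Omega\times\Omega$ such that the diagonal belongs to $\mathcal R$, the transpose of each $s\in\mathcal R$ belongs to $\mathcal R$, and for $r,s,t\in\mathcal R$ the number of $z$ with $(x,z)\in s$, $(z,y)\in t$ does not depend on the choice of $(x,y)\in r$ (commutativity is not required). Its adjacency algebra is the linear span of the adjacency matrices of its relations. *)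

theory Defs
  imports
    Complex_Main
    "HOL-Library.Extended_Nat"
    "HOL-Library.Disjoint_Sets"
    "HOL-Library.Function_Algebras"
    "Graph_Theory.Graph_Theory"
begin
text \<open>
  A finite undirected simple graph is a \<open>pair_graph\<close>: a finite, loop-free, symmetric digraph
  whose arcs are pairs of vertices. The undirected edge \<open>uv\<close> is the set \<open>{u, v}\<close>, and it is
  represented by both arcs \<open>(u, v)\<close> and \<open>(v, u)\<close>.
\<close>

definition edges :: "'a pair_pre_digraph \<Rightarrow> 'a set set" where
  "edges G = {{u, v} | u v. (u, v) \<in> parcs G}"

text \<open>The value of \<open>gdist\<close> is unspecified for vertices not joined by a walk.\<close>

definition gdist :: "'a pair_pre_digraph \<Rightarrow> 'a \<Rightarrow> 'a \<Rightarrow> nat" where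
  "gdist G u v = (LEAST n. \<exists>p. pre_digraph.awalk (with_proj G) u p v \<and> length p = n)"

definition sphere :: "'a pair_pre_digraph \<Rightarrow> nat \<Rightarrow> 'a \<Rightarrow> 'a set" where
  "sphere G i u = {v \<in> pverts G. gdist G u v = i}"

definition ecc :: "'a pair_pre_digraph \<Rightarrow> 'a \<Rightarrow> nat" where
  "ecc G u = Max (gdist G u ` pverts G)"

definition diameter :: "'a pair_pre_digraph \<Rightarrow> nat" where
  "diameter G = Max (ecc G ` pverts G)"

text \<open>
  In a symmetric digraph, traversing an edge back and forth is a \<open>cycle\<close> of length 2 in the sense
  of the library; these are not cycles of the undirected graph. The girth of a forest is \<open>\<infinity>\<close>.
\<close>

definition girth :: "'a pair_pre_digraph \<Rightarrow> enat" where
  "girth G = (INF p \<in> {p. pre_digraph.cycle (with_proj G) p \<and> 3 \<le> length p}. enat (length p))"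

definition girth_deficiency_two :: "'a pair_pre_digraph \<Rightarrow> bool" where
  "girth_deficiency_two G \<longleftrightarrow> girth G = enat (2 * diameter G - 2)"

definition bipartition :: "'a pair_pre_digraph \<Rightarrow> 'a set \<Rightarrow> 'a set \<Rightarrow> bool" where
  "bipartition G A B \<longleftrightarrow> A \<union> B = pverts G \<and> A \<inter> B = {} \<and>
    (\<forall>(x, y) \<in> parcs G. (x \<in> A \<and> y \<in> B) \<or> (x \<in> B \<and> y \<in> A))"

text \<open>
  For \<open>i = 0\<close>, where \<open>\<Gamma>\<^sub>-\<^sub>1(u)\<close> is empty, the truncated subtraction \<open>i - 1 = 0\<close> does no harm:
  \<open>v = u\<close> is not adjacent to itself, so the second number is 0 as well.
\<close>

definition distance_biregular :: "'a pair_pre_digraph \<Rightarrow> 'a set \<Rightarrow> 'a set \<Rightarrow> bool" where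
  "distance_biregular G A B \<longleftrightarrow>
    pair_graph G \<and> connected (with_proj G) \<and> bipartition G A B \<and>
    (\<forall>C \<in> {A, B}. \<exists>b c :: nat \<Rightarrow> nat. \<forall>u \<in> C. \<forall>i \<le> ecc G u. \<forall>v \<in> sphere G i u.
      card (sphere G (i + 1) u \<inter> sphere G 1 v) = b i \<and>
      card (sphere G (i - 1) u \<inter> sphere G 1 v) = c i)"

text \<open>
  The common eccentricity of the vertices of a class \<open>C\<close>. In a distance-biregular graph it exists:
  \<open>ecc G u\<close> is the least \<open>i\<close> for which the number \<open>b i\<close> of the class of \<open>u\<close> vanishes.
\<close>

definition class_ecc :: "'a pair_pre_digraph \<Rightarrow> 'a set \<Rightarrow> nat" where
  "class_ecc G C = (THE e. \<forall>u \<in> C. ecc G u = e)"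

definition unbalanced :: "'a pair_pre_digraph \<Rightarrow> 'a set \<Rightarrow> 'a set \<Rightarrow> bool" where
  "unbalanced G A B \<longleftrightarrow> class_ecc G A \<noteq> class_ecc G B"

definition dist_cell :: "'a pair_pre_digraph \<Rightarrow> nat \<Rightarrow> nat \<Rightarrow> 'a \<Rightarrow> 'a \<Rightarrow> 'a set" where
  "dist_cell G i j u v = sphere G i u \<inter> sphere G j v"

text \<open>
  The arc \<open>(u', v')\<close> is the orientation of the second edge away from \<open>u\<close>; as \<open>G\<close> is bipartite,
  exactly one of the two arcs of that edge qualifies, and \<open>u'\<close> may lie in either class.
\<close>

definition R_up ::
  "'a pair_pre_digraph \<Rightarrow> 'a set \<Rightarrow> 'a set \<Rightarrow> nat \<Rightarrow> ('a set \<times> 'a set) set" where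
  "R_up G A B i = {({u, v}, {u', v'}) | u v u' v'.
     (u, v) \<in> parcs G \<and> u \<in> A \<and> v \<in> B \<and> (u', v') \<in> parcs G \<and> {u, v} \<noteq> {u', v'} \<and>
     gdist G u' u < gdist G v' u \<and> u' \<in> dist_cell G i (i + 1) u v}"

definition R_down ::
  "'a pair_pre_digraph \<Rightarrow> 'a set \<Rightarrow> 'a set \<Rightarrow> nat \<Rightarrow> ('a set \<times> 'a set) set" where
  "R_down G A B i = {({u, v}, {u', v'}) | u v u' v'.
     (u, v) \<in> parcs G \<and> u \<in> A \<and> v \<in> B \<and> (u', v') \<in> parcs G \<and> {u, v} \<noteq> {u', v'} \<and>
     gdist G u' u < gdist G v' u \<and> u' \<in> dist_cell G (i + 1) i u v}"

definition edge_relations ::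
  "'a pair_pre_digraph \<Rightarrow> 'a set \<Rightarrow> 'a set \<Rightarrow> ('a set \<times> 'a set) set set" where
  "edge_relations G A B = {Id_on (edges G)}
     \<union> R_up G A B ` {0..diameter G - 2} \<union> R_down G A B ` {0..diameter G - 2}"

definition association_scheme :: "'e set \<Rightarrow> ('e \<times> 'e) set set \<Rightarrow> bool" where
  "association_scheme \<Omega> \<R> \<longleftrightarrow>
    finite \<Omega> \<and> partition_on (\<Omega> \<times> \<Omega>) \<R> \<and> Id_on \<Omega> \<in> \<R> \<and> (\<forall>s \<in> \<R>. s\<inverse> \<in> \<R>) \<and>
    (\<forall>r \<in> \<R>. \<forall>s \<in> \<R>. \<forall>t \<in> \<R>. \<exists>p :: nat. \<forall>(x, y) \<in> r.
      card {z \<in> \<Omega>. (x, z) \<in> s \<and> (z, y) \<in> t} = p)"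

text \<open>
  A complex matrix with rows and columns indexed by a set \<open>\<Omega>\<close> of elements of type \<open>'e\<close> is a
  function \<open>'e \<Rightarrow> 'e \<Rightarrow> complex\<close> that vanishes outside \<open>\<Omega> \<times> \<Omega>\<close>. Sums of matrices are the
  pointwise sums of \<^theory>\<open>HOL-Library.Function_Algebras\<close>.
\<close>

definition mat_scale :: "complex \<Rightarrow> ('e \<Rightarrow> 'e \<Rightarrow> complex) \<Rightarrow> 'e \<Rightarrow> 'e \<Rightarrow> complex" where
  "mat_scale a M = (\<lambda>x y. a * M x y)"

interpretation cmat: vector_space mat_scale
  by unfold_locales (auto simp: mat_scale_def fun_eq_iff algebra_simps)

definition mat_space :: "'e set \<Rightarrow> ('e \<Rightarrow> 'e \<Rightarrow> complex) set" where
  "mat_space \<Omega> = {M. \<forall>x y. (x, y) \<notin> \<Omega> \<times> \<Omega> \<longrightarrow> M x y = 0}"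

definition adj_matrix :: "('e \<times> 'e) set \<Rightarrow> 'e \<Rightarrow> 'e \<Rightarrow> complex" where
  "adj_matrix s = (\<lambda>x y. if (x, y) \<in> s then 1 else 0)"

lemma adj_matrix_span_subset:
  assumes "\<And>s. s \<in> \<R> \<Longrightarrow> s \<subseteq> \<Omega> \<times> \<Omega>"
  shows "cmat.span (adj_matrix ` \<R>) \<subseteq> mat_space \<Omega>"
proof (rule cmat.span_minimal)
  show "adj_matrix ` \<R> \<subseteq> mat_space \<Omega>"
    using assms by (fastforce simp: mat_space_def adj_matrix_def)
  show "cmat.subspace (mat_space \<Omega>)"
    by (auto simp: cmat.subspace_def mat_space_def mat_scale_def)
qed

text \<open>Intended for the set \<open>\<R>\<close> of relations of an association scheme.\<close>

definition adjacency_algebra :: "('e \<times> 'e) set set \<Rightarrow> ('e \<Rightarrow> 'e \<Rightarrow> complex) set" where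
  "adjacency_algebra \<R> = cmat.span (adj_matrix ` \<R>)"

end

(* Fix an edge e = uv with u in A, v in B. By the girth, a vertex at distance at most 2r from
   another one has only one neighbour closer to it, and for u in A a vertex at distance 2r + 1 has
   c of them. Hence, for a vertex z, the number of edges at z in each relation to e depends only on
   the distances of z from u and v, and these are read off the relation between e and any one edge
   at z. In other words, right multiplication by the adjacency matrices of "equal A-end" and "equal
   B-end" preserves the span of the adjacency matrices of the relations. Starting from the identity,
   these two matrices generate all the others: multiplying the matrix of Up (j - 1) or Down (j - 1)
   by one of them yields its sum with the matrix of Up j or Down j, except that for Down (2r) the
   matrix of Up (2r) is added as well. So right multiplication by any adjacency matrix preserves the
   span, which is the intersection number property. *)
theory Submission
  imports Defs
begin

section \<open>Association schemes from colourings\<close>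

text \<open>Unequal eccentricities enter as the bound \<open>2 * r + 1\<close> on distances from
  vertices of \<open>B\<close>. This bound causes the one irregularity: an edge in
  \<open>Up (2 * r)\<close> cannot recede from \<open>v\<close>, so its end farther from
  \<open>u\<close> returns to distance 2r from \<open>v\<close> and falls into the same distance
  cell as the nearer ends of the edges in \<open>Down (2 * r)\<close>. That cell has distances 2r+1
  from \<open>u\<close> and 2r from \<open>v\<close>, hence lies in \<open>B\<close>; so
  \<open>c\<close> enters only through sums at ends in \<open>B\<close>. The matrices whose right
  multiplication preserves the span are closed under products and differences. In the recursion each
  new relation appears with coefficient 1, because the way back is unique; hence no division occurs
  and integer coefficients suffice. Every relation must also be nonempty, both for the partition and
  for the dimension. A geodesic of length 2r+2 starting in \<open>A\<close> supplies all of them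
  except \<open>Up (2 * r)\<close>, which is found on opposite edges of a shortest cycle.\<close>

lemma sum_fun_apply2: "(\<Sum>i\<in>I. f i) x y = (\<Sum>i\<in>I. f i x y)"
  for f :: "'i \<Rightarrow> 'e \<Rightarrow> 'e \<Rightarrow> complex"
  by (induction I rule: infinite_finite_induct) auto

text \<open>Evaluating a vanishing linear combination at a pair in \<open>t\<close> leaves only the
  coefficient of \<open>t\<close>, by disjointness; such a pair exists because no relation is
  empty.\<close>

lemma dim_span_adj_matrix:
  assumes "finite \<R>" "disjoint \<R>" "{} \<notin> \<R>"
  shows "cmat.dim (cmat.span (adj_matrix ` \<R>)) = card \<R>"
proof -
  have val: "adj_matrix s x y = of_bool (s = t)" if "s \<in> \<R>" "t \<in> \<R>" "(x, y) \<in> t" for s t x y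
    using that assms(2) by (auto simp: adj_matrix_def disjoint_def)
  have inj: "inj_on adj_matrix \<R>"
  proof (rule inj_onI)
    fix s t :: "('a \<times> 'a) set"
    assume st: "s \<in> \<R>" "t \<in> \<R>" "adj_matrix s = adj_matrix t"
    obtain x y where "(x, y) \<in> t" using assms(3) st by (metis ex_in_conv surj_pair)
    then show "s = t" using val[of s t x y] val[of t t x y] st by (auto split: if_splits)
  qed
  have "cmat.independent (adj_matrix ` \<R>)"
  proof (rule cmat.independent_if_scalars_zero)
    fix f M assume z: "(\<Sum>M\<in>adj_matrix ` \<R>. mat_scale (f M) M) = 0" and "M \<in> adj_matrix ` \<R>"
    then obtain t where t: "t \<in> \<R>" "M = adj_matrix t" by auto
    obtain x y where xy: "(x, y) \<in> t" using assms(3) t by (metis ex_in_conv surj_pair)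
    have "0 = (\<Sum>s\<in>\<R>. f (adj_matrix s) * adj_matrix s x y)"
      using fun_cong[OF fun_cong[OF z, of x], of y] inj
      by (simp add: sum.reindex sum_fun_apply2 mat_scale_def)
    also have "\<dots> = (\<Sum>s\<in>\<R>. if s = t then f (adj_matrix s) else 0)"
      by (rule sum.cong) (use val t xy in auto)
    also have "\<dots> = f M" using assms(1) t by simp
    finally show "f M = 0" by simp
  qed (use assms in simp)
  then have "cmat.dim (cmat.span (adj_matrix ` \<R>)) = card (adj_matrix ` \<R>)"
    by (rule cmat.dim_span_eq_card_independent)
  then show ?thesis using inj by (simp add: card_image)
qed

section \<open>Colourings of pairs and matrices compatible with them\<close>

locale colouring =
  fixes \<Omega> :: "'e set" and col :: "'e \<Rightarrow> 'e \<Rightarrow> 'c" and diag :: 'c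
  assumes finite_points: "finite \<Omega>"
    and col_diag: "e \<in> \<Omega> \<Longrightarrow> f \<in> \<Omega> \<Longrightarrow> col e f = diag \<longleftrightarrow> e = f"
begin

text \<open>A function \<open>w\<close> of the colours stands for the matrix with entries \<open>w (col e f)\<close>. It is
  compatible if right multiplication by it preserves the space of matrices of this shape.\<close>

definition compatible :: "('c \<Rightarrow> int) \<Rightarrow> bool" where
  "compatible w \<longleftrightarrow> (\<forall>\<phi> :: 'c \<Rightarrow> int. \<exists>\<psi>. \<forall>e\<in>\<Omega>. \<forall>f\<in>\<Omega>.
     (\<Sum>g\<in>\<Omega>. \<phi> (col e g) * w (col g f)) = \<psi> (col e f))"

definition ind :: "'c \<Rightarrow> 'c \<Rightarrow> int" where
  "ind s c = of_bool (c = s)"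

lemma compatible_ind_diag: "compatible (ind diag)"
  unfolding compatible_def
proof (rule allI)
  fix \<phi> :: "'c \<Rightarrow> int"
  have "(\<Sum>g\<in>\<Omega>. \<phi> (col e g) * ind diag (col g f)) = \<phi> (col e f)" if "e \<in> \<Omega>" "f \<in> \<Omega>" for e f
  proof -
    have "(\<Sum>g\<in>\<Omega>. \<phi> (col e g) * ind diag (col g f)) = (\<Sum>g\<in>\<Omega>. if g = f then \<phi> (col e g) else 0)"
      by (rule sum.cong) (use col_diag that in \<open>auto simp: ind_def\<close>)
    then show ?thesis using finite_points that by simp
  qed
  then show "\<exists>\<psi>. \<forall>e\<in>\<Omega>. \<forall>f\<in>\<Omega>. (\<Sum>g\<in>\<Omega>. \<phi> (col e g) * ind diag (col g f)) = \<psi> (col e f)" by blast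
qed

lemma compatible_add:
  assumes "compatible w" "compatible w'"
  shows "compatible (\<lambda>c. w c + w' c)"
  unfolding compatible_def
proof (rule allI)
  fix \<phi> :: "'c \<Rightarrow> int"
  obtain \<psi> \<psi>' where "\<forall>e\<in>\<Omega>. \<forall>f\<in>\<Omega>. (\<Sum>g\<in>\<Omega>. \<phi> (col e g) * w (col g f)) = \<psi> (col e f)"
    "\<forall>e\<in>\<Omega>. \<forall>f\<in>\<Omega>. (\<Sum>g\<in>\<Omega>. \<phi> (col e g) * w' (col g f)) = \<psi>' (col e f)"
    using assms unfolding compatible_def by meson
  then show "\<exists>\<psi>. \<forall>e\<in>\<Omega>. \<forall>f\<in>\<Omega>. (\<Sum>g\<in>\<Omega>. \<phi> (col e g) * (w (col g f) + w' (col g f))) = \<psi> (col e f)"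
    by (intro exI[of _ "\<lambda>c. \<psi> c + \<psi>' c"]) (simp add: distrib_left sum.distrib)
qed

text \<open>Right multiplications compose: after the two sums are interchanged, multiplying by the
  product means multiplying by \<open>w1\<close> and then by \<open>w2\<close>. Subtracting
  \<open>w3\<close> removes the unwanted summands of a product, so that single colours can be
  isolated one after another.\<close>

lemma compatible_mult_diff:
  assumes "compatible w1" "compatible w2" "compatible w3"
    and w: "\<And>e f. e \<in> \<Omega> \<Longrightarrow> f \<in> \<Omega> \<Longrightarrow>
      w (col e f) = (\<Sum>g\<in>\<Omega>. w1 (col e g) * w2 (col g f)) - w3 (col e f)"
  shows "compatible w"
  unfolding compatible_def
proof (rule allI)
  fix \<phi> :: "'c \<Rightarrow> int"
  obtain \<psi>1 where 1: "\<forall>e\<in>\<Omega>. \<forall>f\<in>\<Omega>. (\<Sum>g\<in>\<Omega>. \<phi> (col e g) * w1 (col g f)) = \<psi>1 (col e f)"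
    using assms(1) unfolding compatible_def by meson
  obtain \<psi>2 where 2: "\<forall>e\<in>\<Omega>. \<forall>f\<in>\<Omega>. (\<Sum>g\<in>\<Omega>. \<psi>1 (col e g) * w2 (col g f)) = \<psi>2 (col e f)"
    using assms(2) unfolding compatible_def by meson
  obtain \<psi>3 where 3: "\<forall>e\<in>\<Omega>. \<forall>f\<in>\<Omega>. (\<Sum>g\<in>\<Omega>. \<phi> (col e g) * w3 (col g f)) = \<psi>3 (col e f)"
    using assms(3) unfolding compatible_def by meson
  have "(\<Sum>g\<in>\<Omega>. \<phi> (col e g) * w (col g f)) = \<psi>2 (col e f) - \<psi>3 (col e f)"
    if ef: "e \<in> \<Omega>" "f \<in> \<Omega>" for e f
  proof -
    have "(\<Sum>g\<in>\<Omega>. \<phi> (col e g) * w (col g f)) =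
        (\<Sum>g\<in>\<Omega>. \<phi> (col e g) * (\<Sum>h\<in>\<Omega>. w1 (col g h) * w2 (col h f)))
        - (\<Sum>g\<in>\<Omega>. \<phi> (col e g) * w3 (col g f))"
      using ef by (simp add: w right_diff_distrib sum_subtractf)
    also have "(\<Sum>g\<in>\<Omega>. \<phi> (col e g) * (\<Sum>h\<in>\<Omega>. w1 (col g h) * w2 (col h f))) =
        (\<Sum>h\<in>\<Omega>. (\<Sum>g\<in>\<Omega>. \<phi> (col e g) * w1 (col g h)) * w2 (col h f))"
      by (simp only: sum_distrib_left sum_distrib_right mult.assoc) (rule sum.swap)
    also have "\<dots> = \<psi>2 (col e f)" using 1 2 ef by simp
    finally show ?thesis using 3 ef by simp
  qed
  then show "\<exists>\<psi>. \<forall>e\<in>\<Omega>. \<forall>f\<in>\<Omega>. (\<Sum>g\<in>\<Omega>. \<phi> (col e g) * w (col g f)) = \<psi> (col e f)"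
    by (intro exI[of _ "\<lambda>c. \<psi>2 c - \<psi>3 c"]) blast
qed

text \<open>The count is an entry of the product of two indicator matrices, which compatibility of
  \<open>ind t\<close> makes a function of the colour.\<close>

lemma compatible_card:
  assumes "compatible (ind t)"
  obtains p where "\<And>e f. e \<in> \<Omega> \<Longrightarrow> f \<in> \<Omega> \<Longrightarrow> card {g \<in> \<Omega>. col e g = s \<and> col g f = t} = p (col e f)"
proof -
  obtain \<psi> where \<psi>: "\<forall>e\<in>\<Omega>. \<forall>f\<in>\<Omega>. (\<Sum>g\<in>\<Omega>. ind s (col e g) * ind t (col g f)) = \<psi> (col e f)"
    using assms unfolding compatible_def by meson
  have "card {g \<in> \<Omega>. col e g = s \<and> col g f = t} = nat (\<psi> (col e f))" if "e \<in> \<Omega>" "f \<in> \<Omega>" for e f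
  proof -
    have "\<psi> (col e f) = (\<Sum>g\<in>\<Omega>. of_bool (col e g = s \<and> col g f = t))"
      using \<psi> that by (simp add: ind_def of_bool_conj)
    also have "\<dots> = int (card {g \<in> \<Omega>. col e g = s \<and> col g f = t})"
      using finite_points by (simp add: of_bool_def sum.If_cases Int_def)
    finally show ?thesis by simp
  qed
  then show thesis using that[of "\<lambda>c. nat (\<psi> c)"] by blast
qed

text \<open>The points are renamed by \<open>h\<close>, since the points of the scheme below are undirected edges
  while colours are easier to define for ordered pairs.\<close>

lemma association_scheme_of_colouring:
  fixes h :: "'e \<Rightarrow> 'b"
  assumes h: "inj_on h \<Omega>"
    and C: "\<And>e f. e \<in> \<Omega> \<Longrightarrow> f \<in> \<Omega> \<Longrightarrow> col e f \<in> C"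
    and attained: "\<And>c. c \<in> C \<Longrightarrow> \<exists>e\<in>\<Omega>. \<exists>f\<in>\<Omega>. col e f = c"
    and tr: "\<And>e f. e \<in> \<Omega> \<Longrightarrow> f \<in> \<Omega> \<Longrightarrow> col f e = tr (col e f)"
    and compat: "\<And>c. c \<in> C \<Longrightarrow> compatible (ind c)"
    and rel: "\<And>c. c \<in> C \<Longrightarrow> rel c = {(h e, h f) | e f. e \<in> \<Omega> \<and> f \<in> \<Omega> \<and> col e f = c}"
    and diag: "diag \<in> C"
  shows "association_scheme (h ` \<Omega>) (rel ` C)" "inj_on rel C"
proof -
  have mem: "(h e, h f) \<in> rel c \<longleftrightarrow> col e f = c" if "e \<in> \<Omega>" "f \<in> \<Omega>" "c \<in> C" for e f c
    unfolding rel[OF that(3)] using that inj_onD[OF h] by blast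
  have relE: "\<exists>e\<in>\<Omega>. \<exists>f\<in>\<Omega>. x = (h e, h f) \<and> col e f = c" if "x \<in> rel c" "c \<in> C" for x c
    using that(1) unfolding rel[OF that(2)] by blast
  have disj: "rel c \<inter> rel c' = {}" if "c \<in> C" "c' \<in> C" "c \<noteq> c'" for c c'
  proof (rule ccontr)
    assume "rel c \<inter> rel c' \<noteq> {}"
    then obtain x where "x \<in> rel c" "x \<in> rel c'" by blast
    then show False using relE[of x c] mem that by blast
  qed
  have ne: "rel c \<noteq> {}" if "c \<in> C" for c
    using attained[OF that] mem that by blast
  show "inj_on rel C" using disj ne by (metis inf.idem inj_onI)
  show "association_scheme (h ` \<Omega>) (rel ` C)"
    unfolding association_scheme_def
  proof (intro conjI ballI)
    show "finite (h ` \<Omega>)" using finite_points by simp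
    show "partition_on (h ` \<Omega> \<times> h ` \<Omega>) (rel ` C)"
    proof (rule partition_onI)
      show "\<Union> (rel ` C) = h ` \<Omega> \<times> h ` \<Omega>"
      proof (rule set_eqI, rule iffI)
        fix x assume "x \<in> h ` \<Omega> \<times> h ` \<Omega>"
        then show "x \<in> \<Union> (rel ` C)" using mem C by auto
      next
        fix x assume "x \<in> \<Union> (rel ` C)"
        then obtain c where "c \<in> C" "x \<in> rel c" by blast
        then show "x \<in> h ` \<Omega> \<times> h ` \<Omega>" using relE[of x c] by blast
      qed
    next
      show "disjnt p q" if "p \<in> rel ` C" "q \<in> rel ` C" "p \<noteq> q" for p q
        using that disj unfolding disjnt_def by blast
      show "{} \<notin> rel ` C" using ne by fastforce
    qed
    have "rel diag = Id_on (h ` \<Omega>)"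
    proof (rule set_eqI, rule iffI)
      fix x assume "x \<in> rel diag"
      then show "x \<in> Id_on (h ` \<Omega>)" using relE[OF _ diag] col_diag by blast
    next
      fix x assume "x \<in> Id_on (h ` \<Omega>)"
      then obtain e where "e \<in> \<Omega>" "x = (h e, h e)" by auto
      then show "x \<in> rel diag" using mem[OF _ _ diag] col_diag by blast
    qed
    then show "Id_on (h ` \<Omega>) \<in> rel ` C" using diag by blast
  next
    fix s assume "s \<in> rel ` C"
    then obtain c where c: "c \<in> C" "s = rel c" by auto
    then have "tr c \<in> C" using attained tr C by metis
    have inv: "tr (tr c') = c'" if "c' \<in> C" for c' using attained[OF that] tr by metis
    have "s\<inverse> = rel (tr c)"
    proof (rule set_eqI, rule iffI)
      fix x assume "x \<in> s\<inverse>"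
      then obtain a b where ab: "x = (b, a)" "(a, b) \<in> rel c" using c by blast
      then obtain e f where "e \<in> \<Omega>" "f \<in> \<Omega>" "x = (h f, h e)" "col e f = c"
        using relE[OF ab(2) c(1)] ab(1) by blast
      then show "x \<in> rel (tr c)" using mem[of f e "tr c"] tr[of e f] \<open>tr c \<in> C\<close> by simp
    next
      fix x assume "x \<in> rel (tr c)"
      then obtain e f where ef: "e \<in> \<Omega>" "f \<in> \<Omega>" "x = (h e, h f)" "col e f = tr c"
        using relE[OF _ \<open>tr c \<in> C\<close>] by blast
      then have "col f e = c" using tr[of e f] inv c by simp
      then show "x \<in> s\<inverse>" using mem ef c by simp
    qed
    then show "s\<inverse> \<in> rel ` C" using \<open>tr c \<in> C\<close> by blast
  next
    fix r s t assume "r \<in> rel ` C" "s \<in> rel ` C" "t \<in> rel ` C"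
    then obtain a b c where abc: "a \<in> C" "b \<in> C" "c \<in> C" "r = rel a" "s = rel b" "t = rel c" by auto
    obtain p where p: "\<And>e f. e \<in> \<Omega> \<Longrightarrow> f \<in> \<Omega> \<Longrightarrow> card {g \<in> \<Omega>. col e g = b \<and> col g f = c} = p (col e f)"
      using compatible_card[OF compat[OF abc(3)]] by blast
    have "card {z \<in> h ` \<Omega>. (x, z) \<in> s \<and> (z, y) \<in> t} = p a" if xy: "(x, y) \<in> r" for x y
    proof -
      obtain e f where ef: "e \<in> \<Omega>" "f \<in> \<Omega>" "x = h e" "y = h f" "col e f = a"
        using relE[of "(x,y)" a] xy abc by auto
      have "{z \<in> h ` \<Omega>. (x, z) \<in> s \<and> (z, y) \<in> t} = h ` {g \<in> \<Omega>. col e g = b \<and> col g f = c}"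
        using mem ef abc by auto
      then have "card {z \<in> h ` \<Omega>. (x, z) \<in> s \<and> (z, y) \<in> t} = card {g \<in> \<Omega>. col e g = b \<and> col g f = c}"
        using inj_on_subset[OF h] by (simp add: card_image)
      then show ?thesis using p ef by simp
    qed
    then show "\<exists>p. \<forall>(x, y)\<in>r. card {z \<in> h ` \<Omega>. (x, z) \<in> s \<and> (z, y) \<in> t} = p" by blast
  qed
qed

end

section \<open>Distances, girth and eccentricities\<close>

locale connected_pair_graph = pair_graph G for G :: "'a pair_pre_digraph" +
  assumes connected_G: "connected (with_proj G)"
begin

abbreviation d :: "'a \<Rightarrow> 'a \<Rightarrow> nat" where "d \<equiv> gdist G"
abbreviation V :: "'a set" where "V \<equiv> pverts G"
abbreviation adj :: "'a \<Rightarrow> 'a \<Rightarrow> bool" where "adj x y \<equiv> (x, y) \<in> parcs G"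

lemma adj_sym: "adj x y \<Longrightarrow> adj y x"
  by (rule arcs_symmetric)

lemma adj_verts: "adj x y \<Longrightarrow> x \<in> V" "adj x y \<Longrightarrow> y \<in> V"
  using wellformed' by auto

lemma adj_neq: "adj x y \<Longrightarrow> x \<noteq> y"
  by (rule no_loops')

lemma gdist_le: "awalk u p v \<Longrightarrow> d u v \<le> length p"
  unfolding gdist_def by (rule Least_le) blast

lemma gdist_awalk:
  assumes "u \<in> V" "v \<in> V"
  obtains p where "awalk u p v" "length p = d u v"
proof -
  have "strongly_connected (with_proj G)"
    using symmetric_connected_imp_strongly_connected[OF sym_arcs connected_G] .
  then have "reachable (with_proj G) u v"
    using assms by (auto simp: strongly_connected_def)
  then obtain p where "awalk u p v" by (auto simp: reachable_awalk)
  then have "\<exists>p. awalk u p v \<and> length p = d u v"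
    unfolding gdist_def
    using LeastI_ex[of "\<lambda>n. \<exists>p. awalk u p v \<and> length p = n"] by blast
  then show thesis using that by blast
qed

lemma gdist_self [simp]: "u \<in> V \<Longrightarrow> d u u = 0"
  using gdist_le[of u "[]" u] by (simp add: awalk_Nil_iff)

lemma gdist_eq_0_iff: "u \<in> V \<Longrightarrow> v \<in> V \<Longrightarrow> d u v = 0 \<longleftrightarrow> u = v"
  using gdist_awalk[of u v] by (metis awalk_Nil_iff gdist_self length_0_conv)

lemma gdist_commute: "u \<in> V \<Longrightarrow> v \<in> V \<Longrightarrow> d u v = d v u"
proof -
  have "d x y \<le> d y x" if xy: "x \<in> V" "y \<in> V" for x y
  proof -
    obtain p where p: "awalk y p x" "length p = d y x" using gdist_awalk xy by blast
    have "length (rev_path p) = length p" by (induct p) auto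
    then show ?thesis using gdist_le[of x "rev_path p" y] p by simp
  qed
  then show "u \<in> V \<Longrightarrow> v \<in> V \<Longrightarrow> d u v = d v u" by (simp add: antisym)
qed

lemma gdist_triangle:
  assumes "u \<in> V" "v \<in> V" "w \<in> V"
  shows "d u w \<le> d u v + d v w"
proof -
  obtain p q where "awalk u p v" "length p = d u v" "awalk v q w" "length q = d v w"
    using gdist_awalk assms by metis
  then show ?thesis using gdist_le[of u "p @ q" w] by auto
qed

lemma gdist_adj: "adj x y \<Longrightarrow> d x y = 1"
proof -
  assume a: "adj x y"
  have "d x y \<le> 1" using gdist_le[of x "[(x,y)]" y] a adj_verts[OF a]
    by (auto simp: awalk_simps)
  moreover have "d x y \<noteq> 0" using a adj_verts[OF a] adj_neq gdist_eq_0_iff by blast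
  ultimately show ?thesis by simp
qed

lemma gdist_eq_1_iff: "x \<in> V \<Longrightarrow> y \<in> V \<Longrightarrow> d x y = 1 \<longleftrightarrow> adj x y"
proof (intro iffI)
  assume V: "x \<in> V" "y \<in> V" and 1: "d x y = 1"
  then obtain p where "awalk x p y" "length p = 1" using gdist_awalk[OF V] by metis
  then show "adj x y" by (auto simp: length_Suc_conv awalk_simps)
qed (rule gdist_adj)

lemma gdist_adj_le: "u \<in> V \<Longrightarrow> adj x y \<Longrightarrow> d u y \<le> d u x + 1"
  using gdist_triangle[of u x y] gdist_adj[of x y] adj_verts[of x y] by simp

lemma sphere_1: "x \<in> V \<Longrightarrow> sphere G 1 x = {y. adj x y}"
  unfolding sphere_def using gdist_eq_1_iff[of x] adj_verts(2)[of x] by blast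

lemma gdist_pred:
  assumes "u \<in> V" "w \<in> V" "d u w = Suc n"
  obtains x where "adj x w" "d u x = n"
proof -
  obtain p where p: "awalk u p w" "length p = Suc n" using gdist_awalk assms by metis
  then obtain q e where pe: "p = q @ [e]" by (metis length_Suc_conv_rev)
  obtain x y where e: "e = (x,y)" by force
  have q: "awalk u q x" "adj x w" using p e pe by (auto simp: awalk_simps)
  then have "d u x \<le> n" using gdist_le[of u q x] p pe by simp
  moreover have "Suc n \<le> d u x + 1" using gdist_adj_le[OF assms(1) q(2)] assms by simp
  ultimately show thesis using that q by auto
qed

section \<open>Geodesics, cycles and girth\<close>

lemma geodesic:
  assumes "u \<in> V" "w \<in> V" "d u w = n"
  obtains z where "z 0 = u" "z n = w" "\<And>i. i < n \<Longrightarrow> adj (z i) (z (Suc i))"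
    "\<And>i. i \<le> n \<Longrightarrow> d u (z i) = i"
proof -
  have "\<exists>z. z 0 = u \<and> z n = w \<and> (\<forall>i<n. adj (z i) (z (Suc i))) \<and> (\<forall>i\<le>n. d u (z i) = i)"
    using assms(2,3)
  proof (induction n arbitrary: w)
    case 0
    then show ?case using assms(1) gdist_eq_0_iff[of u w] by (intro exI[of _ "\<lambda>_. u"]) auto
  next
    case (Suc n)
    obtain x where x: "adj x w" "d u x = n" using gdist_pred[OF assms(1) Suc.prems] by blast
    obtain z where z: "z 0 = u" "z n = x" "\<forall>i<n. adj (z i) (z (Suc i))" "\<forall>i\<le>n. d u (z i) = i"
      using Suc.IH[OF adj_verts(1)[OF x(1)] x(2)] by blast
    show ?case
      using z x Suc.prems
      by (intro exI[of _ "z(Suc n := w)"]) (auto simp: less_Suc_eq le_Suc_eq)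
  qed
  then show thesis using that by blast
qed

lemma awalk_of_fun:
  assumes "z 0 \<in> V" "\<And>i. i < n \<Longrightarrow> adj (z i) (z (Suc i))"
  shows "awalk (z 0) (map (\<lambda>i. (z i, z (Suc i))) [0..<n]) (z n)"
  using assms
proof (induction n)
  case 0
  then show ?case by (simp add: awalk_Nil_iff)
next
  case (Suc n)
  then show ?case using adj_verts[of "z n" "z (Suc n)"] by (auto simp: awalk_simps)
qed

lemma gdist_geodesic_le:
  assumes "\<And>i. i < n \<Longrightarrow> adj (z i) (z (Suc i))" "i \<le> j" "j \<le> n" "z i \<in> V"
  shows "d (z i) (z j) \<le> j - i"
  using gdist_le[OF awalk_of_fun[of "\<lambda>t. z (i + t)" "j - i"]] assms by simp

lemma girth_le:
  assumes "3 \<le> n" "\<And>i. i < n \<Longrightarrow> adj (z i) (z (Suc i))" "z n = z 0" "inj_on z {..<n}"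
  shows "girth G \<le> enat n"
proof -
  let ?p = "map (\<lambda>i. (z i, z (Suc i))) [0..<n]"
  have "z 0 \<in> V" using adj_verts(1)[OF assms(2)[of 0]] assms(1) by simp
  then have w: "awalk (z 0) ?p (z 0)" using awalk_of_fun[of z n] assms by simp
  have "cas (z 0) ?p (z 0)" using w by auto
  then have "tl (pawalk_verts (z 0) ?p) = map snd ?p"
    using awalk_verts_conv'[of "z 0" ?p "z 0"] assms(1) by simp
  also have "\<dots> = map (\<lambda>i. z (Suc i)) [0..<n]" by simp
  finally have tl: "tl (pawalk_verts (z 0) ?p) = map (\<lambda>i. z (Suc i)) [0..<n]" .
  have "inj_on (\<lambda>i. z (Suc i)) {..<n}"
  proof (rule inj_onI)
    fix i j assume ij: "i \<in> {..<n}" "j \<in> {..<n}" "z (Suc i) = z (Suc j)"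
    \<comment> \<open>The vertices after the first have the indices 1 to \<open>n\<close>; replacing
      \<open>n\<close> by 0 returns to the range on which \<open>z\<close> is injective.\<close>
    have "z (Suc k) = z (if Suc k = n then 0 else Suc k)" for k using assms(3) by auto
    then have "z (if Suc i = n then 0 else Suc i) = z (if Suc j = n then 0 else Suc j)"
      using ij(3) by metis
    then have "(if Suc i = n then 0 else Suc i) = (if Suc j = n then 0 else Suc j)"
      by (rule inj_onD[OF assms(4)]) (use ij assms(1) in auto)
    then show "i = j" by (auto split: if_splits)
  qed
  then have "distinct (tl (pawalk_verts (z 0) ?p))"
    unfolding tl by (simp add: distinct_map atLeast0LessThan)
  then have "cycle ?p" unfolding cycle_def using w assms(1) by auto
  then have "enat (length ?p) \<in> (\<lambda>p. enat (length p)) ` {p. cycle p \<and> 3 \<le> length p}"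
    using assms(1) by (intro imageI) simp
  then have "girth G \<le> enat (length ?p)" unfolding girth_def by (rule Inf_lower)
  then show ?thesis by simp
qed

text \<open>A finite infimum in \<open>enat\<close> is attained. The shortest cycle is extended
  periodically to all indices, so that one can walk past its starting point from any of its
  vertices.\<close>

lemma girth_attained:
  assumes "girth G = enat n"
  obtains z where "3 \<le> n" "\<And>i. adj (z i) (z (Suc i))" "\<And>i. z (i + n) = z i" "inj_on z {..<n}"
proof -
  let ?S = "(\<lambda>p. enat (length p)) ` {p. cycle p \<and> 3 \<le> length p}"
  have "?S \<noteq> {}" using assms unfolding girth_def Inf_enat_def by (metis enat.simps(3))
  then obtain a where "a \<in> ?S" by blast
  then have "(LEAST x. x \<in> ?S) \<in> ?S" by (rule LeastI)
  then have "girth G \<in> ?S" using \<open>?S \<noteq> {}\<close> unfolding girth_def Inf_enat_def by auto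
  then obtain p where p: "cycle p" "3 \<le> length p" "length p = n" using assms by auto
  then obtain u where u: "awalk u p u" "distinct (tl (pawalk_verts u p))" unfolding cycle_def by auto
  have cas: "cas u p u" using u by auto
  then have tl: "tl (pawalk_verts u p) = map snd p"
    using awalk_verts_conv'[of u p u] p by auto
  have vs: "map fst p @ [snd (last p)] = fst (hd p) # map snd p"
  proof -
    have "p \<noteq> []" using p by auto
    then show ?thesis using awalk_verts_conv[of u p] awalk_verts_conv'[of u p u] cas by simp
  qed
  have closed: "fst (hd p) = snd (last p)"
  proof -
    have "fst (hd p) = u" using u p by (cases p) (auto simp: awalk_simps)
    moreover have "snd (last p) = u"
      using u p by (cases p rule: rev_cases) (auto simp: awalk_simps)
    ultimately show ?thesis by simp
  qed
  define z where "z i = snd (p ! (i mod n))" for i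
  have n: "n > 0" using p by simp
  have step: "adj (z i) (z (Suc i))" for i
  proof -
    let ?i = "i mod n" and ?j = "Suc i mod n"
    have j: "?j < n" using n by simp
    have "fst (p ! ?j) = snd (p ! ?i)"
    proof (cases "Suc ?i = n")
      case True
      then have "?j = 0" by (simp add: mod_Suc)
      then show ?thesis using closed p True n by (metis One_nat_def diff_Suc_1 hd_conv_nth last_conv_nth length_0_conv not_less0)
    next
      case False
      then have je: "?j = Suc ?i" by (simp add: mod_Suc)
      have "(map fst p @ [snd (last p)]) ! ?j = (fst (hd p) # map snd p) ! ?j" using vs by simp
      then show ?thesis using j je p by (simp add: nth_append)
    qed
    moreover have "p ! ?j \<in> parcs G" using awalkE[OF u(1)] nth_mem[of ?j p] p(3) j by blast
    ultimately show ?thesis unfolding z_def by (metis prod.collapse)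
  qed
  have "inj_on z {..<n}"
    using u(2) p(3) unfolding tl z_def by (auto simp: inj_on_def distinct_conv_nth)
  then show thesis using that[of z] step p by (simp add: z_def)
qed

text \<open>Two geodesics from \<open>u\<close> to \<open>x\<close> with distinct last steps enclose a cycle from the last vertex
  before \<open>x\<close> that they have in common.\<close>

lemma girth_le_of_two_preds:
  assumes "u \<in> V" "adj y x" "adj y' x" "y \<noteq> y'" "d u x = Suc m" "d u y = m" "d u y' = m"
  shows "girth G \<le> enat (2 * (m + 1))"
proof -
  obtain p where p: "p 0 = u" "p m = y" "\<And>i. i < m \<Longrightarrow> adj (p i) (p (Suc i))"
    "\<And>i. i \<le> m \<Longrightarrow> d u (p i) = i"
    using geodesic assms adj_verts by metis
  obtain q where q: "q 0 = u" "q m = y'" "\<And>i. i < m \<Longrightarrow> adj (q i) (q (Suc i))"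
    "\<And>i. i \<le> m \<Longrightarrow> d u (q i) = i"
    using geodesic assms adj_verts by metis
  \<comment> \<open>Comparing equal indices is enough: the index is the distance from
    \<open>u\<close>, so the two geodesics can only meet at equal indices.\<close>
  define i where "i = (GREATEST i. i \<le> m \<and> p i = q i)"
  have ex: "0 \<le> m \<and> p 0 = q 0" using p q by simp
  have i: "i \<le> m" "p i = q i"
    using GreatestI_nat[of "\<lambda>i. i \<le> m \<and> p i = q i" 0 m] ex unfolding i_def by auto
  have max: "j \<le> i" if "j \<le> m" "p j = q j" for j
    using Greatest_le_nat[of "\<lambda>i. i \<le> m \<and> p i = q i" j m] that unfolding i_def by auto
  have im: "i < m" using i p q assms(4) by (metis le_neq_implies_less)
  define s where "s = m + 1 - i"
  \<comment> \<open>The cycle climbs from the branching vertex along \<open>p\<close> to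
    \<open>x\<close> in \<open>s\<close> steps and descends along \<open>q\<close>; at
    \<open>t = 2 * s\<close> the index on \<open>q\<close> is \<open>i\<close> again.\<close>
  define z where "z t = (if t < s then p (i + t) else if t = s then x else q (i + (2 * s - t)))" for t
  have s: "s \<ge> 2" "i + s = m + 1" using im unfolding s_def by auto
  have "girth G \<le> enat (2 * s)"
  proof (rule girth_le[of _ z])
    show "3 \<le> 2 * s" using s by simp
    show "z (2 * s) = z 0" using s i by (simp add: z_def)
    show "adj (z t) (z (Suc t))" if t: "t < 2 * s" for t
    proof -
      consider "Suc t < s" | "Suc t = s" | "t = s" | "t > s" by linarith
      then show ?thesis
      proof cases
        case 1 then show ?thesis using p(3)[of "i + t"] s by (simp add: z_def)
      next
        case 2 then have "i + t = m" using s by simp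
        then show ?thesis using 2 p assms by (simp add: z_def)
      next
        case 3 then have "i + (2 * s - Suc t) = m" using s by simp
        then show ?thesis using 3 q assms adj_sym by (simp add: z_def)
      next
        case 4
        then have "i + (2 * s - t) = Suc (i + (2 * s - Suc t))" "i + (2 * s - Suc t) < m" using s t by auto
        then show ?thesis using 4 q(3)[of "i + (2 * s - Suc t)"] adj_sym by (simp add: z_def)
      qed
    qed
    have dz: "d u (z t) = i + (if t \<le> s then t else 2 * s - t)" if "t < 2 * s" for t
      using that p(4)[of "i + t"] q(4)[of "i + (2 * s - t)"] assms(5) s by (auto simp: z_def)
    \<comment> \<open>Coinciding vertices on the two sides have the same distance from
      \<open>u\<close>, hence the same index on \<open>p\<close> and \<open>q\<close>. Maximality of
      \<open>i\<close> then gives \<open>t = 0\<close>, which would require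
      \<open>t' = 2 * s\<close>.\<close>
    have cross: "z t \<noteq> z t'" if "t < s" "s < t'" "t' < 2 * s" for t t'
    proof
      assume e: "z t = z t'"
      then have "i + t = i + (2 * s - t')" using dz[of t] dz[of t'] that by simp
      moreover have "p (i + t) = q (i + (2 * s - t'))" using e that by (simp add: z_def)
      ultimately have "p (i + t) = q (i + t)" by simp
      then have "t = 0" using max[of "i + t"] that s by simp
      then show False using \<open>i + t = i + (2 * s - t')\<close> that by simp
    qed
    show "inj_on z {..<2 * s}"
    proof (rule inj_onI)
      fix t t' assume t: "t \<in> {..<2 * s}" "t' \<in> {..<2 * s}" and e: "z t = z t'"
      have f: "(if t \<le> s then t else 2 * s - t) = (if t' \<le> s then t' else 2 * s - t')"
        using dz[of t] dz[of t'] e t by simp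
      consider "t \<le> s" "t' \<le> s" | "t > s" "t' > s" | "t \<le> s" "t' > s" | "t > s" "t' \<le> s"
        by linarith
      then show "t = t'"
      proof cases
        case 3
        then have "t < s" using f t by auto
        then show ?thesis using cross[of t t'] e t 3 by simp
      next
        case 4
        then have "t' < s" using f t by auto
        then show ?thesis using cross[of t' t] e t 4 by simp
      qed (use f t in auto)
    qed
  qed
  also have "\<dots> \<le> enat (2 * (m + 1))" by (simp add: s_def)
  finally show ?thesis .
qed

section \<open>Eccentricities\<close>

lemma gdist_le_ecc: "u \<in> V \<Longrightarrow> x \<in> V \<Longrightarrow> d u x \<le> ecc G u"
  unfolding ecc_def using pair_finite_verts by simp

lemma ecc_attained:
  assumes "u \<in> V"
  obtains x where "x \<in> V" "d u x = ecc G u"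
proof -
  have "ecc G u \<in> d u ` V" unfolding ecc_def using pair_finite_verts assms by (intro Max_in) auto
  then show thesis using that by auto
qed

lemma ecc_le_diameter: "u \<in> V \<Longrightarrow> ecc G u \<le> diameter G"
  unfolding diameter_def using pair_finite_verts by simp

lemma diameter_attained:
  obtains u where "u \<in> V" "ecc G u = diameter G"
proof -
  have "V \<noteq> {}" using connected_G by (auto simp: connected_conv)
  then have "diameter G \<in> ecc G ` V" unfolding diameter_def using pair_finite_verts by (intro Max_in) auto
  then show thesis using that by auto
qed

text \<open>A vertex farthest from \<open>u\<close> shows that \<open>b (ecc G u) = 0\<close>. A
  vertex \<open>w\<close> of the same class with larger eccentricity has a geodesic that continues
  past this distance, which would make the same number positive.\<close>

lemma class_ecc_eq:
  assumes "C \<subseteq> V" "u \<in> C"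
    and b: "\<And>u i v. u \<in> C \<Longrightarrow> i \<le> ecc G u \<Longrightarrow> v \<in> sphere G i u \<Longrightarrow>
      card (sphere G (i + 1) u \<inter> sphere G 1 v) = b i"
  shows "ecc G u = class_ecc G C"
proof -
  have le: "ecc G w \<le> ecc G u" if w: "u \<in> C" "w \<in> C" for u w
  proof (rule ccontr)
    assume "\<not> ecc G w \<le> ecc G u"
    then have less: "ecc G u < ecc G w" by simp
    have V: "u \<in> V" "w \<in> V" using assms w by auto
    obtain x where x: "x \<in> V" "d u x = ecc G u" using ecc_attained[OF V(1)] by metis
    have "sphere G (ecc G u + 1) u = {}"
      using gdist_le_ecc[OF V(1)] by (fastforce simp: sphere_def)
    moreover have "x \<in> sphere G (ecc G u) u" using x by (simp add: sphere_def)
    ultimately have b0: "b (ecc G u) = 0" using b[OF w(1), of "ecc G u" x] by simp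
    obtain y where y: "y \<in> V" "d w y = ecc G w" using ecc_attained[OF V(2)] by metis
    obtain z where z: "\<And>i. i < ecc G w \<Longrightarrow> adj (z i) (z (Suc i))" "\<And>i. i \<le> ecc G w \<Longrightarrow> d w (z i) = i"
      using geodesic[OF V(2) y] by metis
    have a: "adj (z (ecc G u)) (z (Suc (ecc G u)))" using z(1) less by simp
    have "z (ecc G u) \<in> sphere G (ecc G u) w"
      using adj_verts[OF a] z(2) less by (simp add: sphere_def)
    then have "card (sphere G (ecc G u + 1) w \<inter> sphere G 1 (z (ecc G u))) = 0"
      using b[OF w(2), of "ecc G u"] b0 less by simp
    moreover have "finite (sphere G (ecc G u + 1) w)" using pair_finite_verts by (simp add: sphere_def)
    moreover have "z (Suc (ecc G u)) \<in> sphere G (ecc G u + 1) w \<inter> sphere G 1 (z (ecc G u))"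
      using adj_verts[OF a] z(2) less gdist_adj[OF a] by (simp add: sphere_def)
    ultimately show False by (metis card_eq_0_iff empty_iff finite_Int)
  qed
  show ?thesis unfolding class_ecc_def
    by (rule the_equality[symmetric]) (use le assms(2) in \<open>auto intro: antisym\<close>)
qed

end

section \<open>The relation of an edge to the edges at a vertex\<close>

locale bipartite_graph = connected_pair_graph +
  fixes A B :: "'a set"
  assumes bipartition: "bipartition G A B"
begin

lemma AB: "A \<union> B = V" "A \<inter> B = {}"
  using bipartition by (auto simp: bipartition_def)

lemma adj_classes: "adj x y \<Longrightarrow> x \<in> A \<and> y \<in> B \<or> x \<in> B \<and> y \<in> A"
  using bipartition by (auto simp: bipartition_def)

lemma in_V: "x \<in> A \<Longrightarrow> x \<in> V" "x \<in> B \<Longrightarrow> x \<in> V"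
  using AB by auto

lemma even_gdist:
  assumes "u \<in> V" "x \<in> V"
  shows "even (d u x) \<longleftrightarrow> (u \<in> A \<longleftrightarrow> x \<in> A)"
  using assms(2)
proof (induction "d u x" arbitrary: x)
  case 0
  then show ?case using gdist_eq_0_iff[of u x] assms by simp
next
  case (Suc n)
  obtain y where y: "adj y x" "d u y = n" using gdist_pred[OF assms(1) Suc.prems] Suc.hyps by metis
  then have "even n \<longleftrightarrow> (u \<in> A \<longleftrightarrow> y \<in> A)" using Suc.hyps(1)[of y] adj_verts by auto
  moreover have "y \<in> A \<longleftrightarrow> x \<notin> A" using adj_classes[OF y(1)] AB(2) by auto
  ultimately show ?case using Suc.hyps(2)[symmetric] by auto
qed

lemma gdist_adj_cases:
  assumes "u \<in> V" "adj x y"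
  shows "d u y = d u x + 1 \<or> d u x = d u y + 1"
proof -
  have "even (d u x) \<longleftrightarrow> odd (d u y)"
    using even_gdist[OF assms(1) adj_verts(1)[OF assms(2)]]
      even_gdist[OF assms(1) adj_verts(2)[OF assms(2)]] adj_classes[OF assms(2)] AB(2) by auto
  then have "d u x \<noteq> d u y" by auto
  moreover have "d u y \<le> d u x + 1" "d u x \<le> d u y + 1"
    using gdist_adj_le[OF assms] gdist_adj_le[OF assms(1) adj_sym[OF assms(2)]] .
  ultimately show ?thesis by linarith
qed

lemma gdist_adj_cases':
  assumes "u \<in> V" "adj x y"
  shows "d y u = d x u + 1 \<or> d x u = d y u + 1"
  using gdist_adj_cases[OF assms] gdist_commute assms adj_verts by metis

end

datatype colour = Diag | Up nat | Down nat

text \<open>The parameter \<open>c\<close> is the intersection number \<open>c\<^sub>2\<^sub>r\<^sub>+\<^sub>1\<close> of the class \<open>A\<close>, the only one that the girth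
  does not determine among those needed.\<close>

locale deficient_graph = bipartite_graph +
  fixes r k l c :: nat
  assumes r_pos: "1 \<le> r"
    and gdist_le_diam: "\<And>x y. x \<in> V \<Longrightarrow> y \<in> V \<Longrightarrow> d x y \<le> 2 * r + 2"
    and gdist_B_le: "\<And>v x. v \<in> B \<Longrightarrow> x \<in> V \<Longrightarrow> d v x \<le> 2 * r + 1"
    and girth_G: "girth G = enat (4 * r + 2)"
    and deg_A: "\<And>x. x \<in> A \<Longrightarrow> card {y. adj x y} = Suc k"
    and deg_B: "\<And>x. x \<in> B \<Longrightarrow> card {y. adj x y} = Suc l"
    and preds_A: "\<And>u x. u \<in> A \<Longrightarrow> x \<in> V \<Longrightarrow> d u x = 2 * r + 1 \<Longrightarrow>
      card {y. adj x y \<and> d u y = 2 * r} = c"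
    and far: "\<exists>u\<in>A. \<exists>x\<in>V. d u x = 2 * r + 2"
begin

text \<open>Two such neighbours would give a cycle of length at most \<open>2 * (m + 1)\<close>,
  which is at most 4r and so below the girth 4r+2.\<close>

lemma pred_unique:
  assumes "u \<in> V" "adj y x" "adj y' x" "d u x = Suc m" "d u y = m" "d u y' = m" "m < 2 * r"
  shows "y = y'"
proof (rule ccontr)
  assume "y \<noteq> y'"
  from girth_le_of_two_preds[OF assms(1-3) this assms(4-6)] show False
    using assms(7) by (simp add: girth_G)
qed

text \<open>The colour of the edge \<open>xy\<close> relative to \<open>uv\<close>; the endpoint of \<open>xy\<close> nearer to \<open>u\<close> plays
  the role of \<open>u'\<close>.\<close>

definition ecol :: "'a \<Rightarrow> 'a \<Rightarrow> 'a \<Rightarrow> 'a \<Rightarrow> colour" where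
  "ecol u v x y = (if {x, y} = {u, v} then Diag else
     let z = (if d u x < d u y then x else y) in if d u z < d v z then Up (d u z) else Down (d v z))"

lemma ecol_Up:
  assumes "d u z = i" "d v z = i + 1" "d u w = i + 1" "{z, w} \<noteq> {u, v}"
  shows "ecol u v z w = Up i" "ecol u v w z = Up i"
  using assms by (auto simp: ecol_def Let_def insert_commute)

lemma ecol_Down:
  assumes "u \<in> V" "v \<in> V" "d v z = i" "d u z = i + 1" "d u w = i + 2"
  shows "ecol u v z w = Down i" "ecol u v w z = Down i"
proof -
  have "{z, w} \<noteq> {u, v}"
    using assms gdist_self[of u] by (auto simp: doubleton_eq_iff)
  then show "ecol u v z w = Down i" "ecol u v w z = Down i"
    using assms by (auto simp: ecol_def Let_def insert_commute)
qed

text \<open>Bipartiteness settles all distances except that from \<open>v\<close> to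
  \<open>w\<close> in the case \<open>Up\<close>. If it were \<open>i\<close> with
  \<open>0 < i < 2 * r\<close>, the last vertex before \<open>w\<close> on a geodesic from
  \<open>v\<close> would be a second neighbour of \<open>w\<close> nearer to \<open>u\<close>; if it
  were \<open>i = 0\<close>, the edge would be \<open>uv\<close>. For \<open>i = 2 * r\<close> the
  bound on distances from \<open>B\<close> forces the value \<open>i\<close>.\<close>

lemma ecol_cases:
  assumes uv: "u \<in> A" "v \<in> B" "adj u v" and xy: "adj x y"
  obtains
    (Diag) "{x, y} = {u, v}" "ecol u v x y = Diag"
  | (Up) z w i where "{x, y} = {z, w}" "adj z w" "i \<le> 2 * r" "d u z = i" "d v z = i + 1"
      "d u w = i + 1" "d v w = (if i = 2 * r then i else i + 2)" "{z, w} \<noteq> {u, v}"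
      "ecol u v x y = Up i"
  | (Down) z w i where "{x, y} = {z, w}" "adj z w" "i \<le> 2 * r" "d v z = i" "d u z = i + 1"
      "d u w = i + 2" "d v w = i + 1" "ecol u v x y = Down i"
proof (cases "{x, y} = {u, v}")
  case True
  then show thesis using Diag by (simp add: ecol_def)
next
  case neq: False
  have uvV: "u \<in> V" "v \<in> V" using uv in_V by auto
  obtain z w where zw: "{x, y} = {z, w}" "adj z w" "d u w = d u z + 1"
    using gdist_adj_cases[OF uvV(1) xy] xy adj_sym[OF xy] by (metis insert_commute)
  have V: "z \<in> V" "w \<in> V" using zw adj_verts by auto
  have vz: "d v z = d u z + 1 \<or> d u z = d v z + 1"
    using gdist_adj_cases'[OF V(1) uv(3)] .
  have vw: "d v w = d u w + 1 \<or> d u w = d v w + 1"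
    using gdist_adj_cases'[OF V(2) uv(3)] .
  have vzw: "d v w = d v z + 1 \<or> d v z = d v w + 1" using gdist_adj_cases[OF uvV(2) zw(2)] .
  have cxy: "ecol u v x y = ecol u v z w \<or> ecol u v x y = ecol u v w z"
    using zw(1) by (auto simp: doubleton_eq_iff)
  from vz show thesis
  proof
    assume 1: "d v z = d u z + 1"
    obtain i where i_def: "d u z = i" by simp
    have i: "i \<le> 2 * r" using gdist_B_le[OF uv(2) V(1)] 1 i_def by simp
    have "d v w = (if i = 2 * r then i else i + 2)"
    proof (cases "i = 2 * r")
      case True
      then show ?thesis using gdist_B_le[OF uv(2) V(2)] vzw 1 i_def by auto
    next
      case False
      have "d v w \<noteq> i"
      proof
        assume e: "d v w = i"
        show False
        proof (cases i)
          case 0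
          then have "z = u" "w = v" using gdist_eq_0_iff V uvV e i_def by auto
          then show False using neq zw(1) by simp
        next
          case (Suc m)
          obtain q where q: "adj q w" "d v q = m"
            using gdist_pred[OF uvV(2) V(2)] e Suc by metis
          have "d u q \<le> i" using gdist_adj_cases'[OF adj_verts(1)[OF q(1)] uv(3)] q(2) Suc by linarith
          moreover have "i \<le> d u q" using gdist_adj_le[OF uvV(1) q(1)] zw(3) i_def by linarith
          ultimately have "d u q = i" by simp
          have "z = q"
          proof (rule pred_unique[OF uvV(1) zw(2) q(1)])
            show "d u w = Suc i" using zw(3) i_def by simp
          qed (use \<open>d u q = i\<close> i False i_def in auto)
          then show False using q 1 Suc i_def by simp
        qed
      qed
      then show ?thesis using False vzw 1 i_def by auto
    qed
    moreover have "ecol u v x y = Up i" using cxy ecol_Up[of u z i v w] zw(1,3) neq 1 i_def by simp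
    ultimately show thesis using Up[OF zw(1,2) i i_def] 1 zw(1,3) neq i_def by simp
  next
    assume 1: "d u z = d v z + 1"
    obtain i where i_def: "d v z = i" by simp
    have "i \<le> 2 * r" using gdist_le_diam[OF uvV(1) V(2)] zw(3) 1 i_def by simp
    moreover have "d v w = i + 1" using 1 zw(3) vw vzw i_def by linarith
    moreover have "ecol u v x y = Down i" using cxy ecol_Down[OF uvV i_def, of w] zw(3) 1 i_def by simp
    ultimately show thesis using Down[OF zw(1,2) _ i_def] 1 zw(3) i_def by simp
  qed
qed

section \<open>Sums over the edges at a vertex\<close>

definition nbr_sum :: "(colour \<Rightarrow> int) \<Rightarrow> 'a \<Rightarrow> 'a \<Rightarrow> 'a \<Rightarrow> int" where
  "nbr_sum \<phi> u v z = (\<Sum>w\<in>{w. adj z w}. \<phi> (ecol u v z w))"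

text \<open>This is the value of \<open>nbr_sum\<close> at a vertex of degree \<open>n + 1\<close>
  with distances \<open>j\<close> from \<open>u\<close> and \<open>j + 1\<close> from
  \<open>v\<close>: one edge leads back and the other \<open>n\<close> lead away from
  \<open>u\<close>. For \<open>j = 0\<close> the special edge is \<open>uv\<close> itself.\<close>

definition up_sum :: "nat \<Rightarrow> (colour \<Rightarrow> int) \<Rightarrow> nat \<Rightarrow> int" where
  "up_sum n \<phi> j = (if j = 0 then \<phi> Diag else \<phi> (Up (j - 1))) + int n * \<phi> (Up j)"

text \<open>The counterpart for distances \<open>j + 1\<close> from \<open>u\<close> and
  \<open>j\<close> from \<open>v\<close>. For \<open>j = 2 * r\<close>, one of the \<open>c\<close>
  neighbours nearer to \<open>u\<close> is also nearer to \<open>v\<close>, and the other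
  \<open>c - 1\<close> contribute \<open>Up (2 * r)\<close>. For \<open>j = 2 * r + 1\<close> both
  distances are maximal, so every edge leads back.\<close>

definition down_sum :: "nat \<Rightarrow> (colour \<Rightarrow> int) \<Rightarrow> nat \<Rightarrow> int" where
  "down_sum n \<phi> j =
    (if j = 0 then \<phi> Diag + int n * \<phi> (Down 0)
     else if j < 2 * r then \<phi> (Down (j - 1)) + int n * \<phi> (Down j)
     else if j = 2 * r then \<phi> (Down (2 * r - 1)) + (int c - 1) * \<phi> (Up (2 * r))
       + (int n + 1 - int c) * \<phi> (Down (2 * r))
     else (int n + 1) * \<phi> (Down (2 * r)))"

lemma finite_nbrs: "finite {w. adj z w}"
  by (rule finite_subset[OF _ pair_finite_verts]) (use adj_verts in auto)

lemma nbr_sum_single: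
  assumes "card {w. adj z w} = Suc n" "adj z w0" "\<phi> (ecol u v z w0) = a"
    and "\<And>w. adj z w \<Longrightarrow> w \<noteq> w0 \<Longrightarrow> \<phi> (ecol u v z w) = b"
  shows "nbr_sum \<phi> u v z = a + int n * b"
proof -
  have "nbr_sum \<phi> u v z = a + (\<Sum>w\<in>{w. adj z w} - {w0}. \<phi> (ecol u v z w))"
    unfolding nbr_sum_def using finite_nbrs assms(2,3) by (subst sum.remove[of _ w0]) auto
  also have "(\<Sum>w\<in>{w. adj z w} - {w0}. \<phi> (ecol u v z w)) = (\<Sum>w\<in>{w. adj z w} - {w0}. b)"
    by (rule sum.cong) (use assms(4) in auto)
  also have "\<dots> = int n * b" using assms(1,2) finite_nbrs by (simp add: card_Diff_singleton)
  finally show ?thesis .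
qed

lemma nbr_sum_up:
  assumes uv: "u \<in> A" "v \<in> B" "adj u v" and z: "z \<in> V" "card {w. adj z w} = Suc n"
    and j: "d u z = j" "d v z = j + 1" "j \<le> 2 * r"
  shows "nbr_sum \<phi> u v z = up_sum n \<phi> j"
proof (cases j)
  case 0
  have uvV: "u \<in> V" "v \<in> V" using uv in_V by auto
  have zu: "z = u" using 0 j gdist_eq_0_iff[OF uvV(1) z(1)] by simp
  have "ecol u v u v = Diag" by (simp add: ecol_def)
  moreover have "ecol u v u w = Up 0" if "adj u w" "w \<noteq> v" for w
    by (rule ecol_Up) (use that j zu 0 gdist_adj in \<open>auto simp: doubleton_eq_iff\<close>)
  ultimately show ?thesis
    unfolding zu using nbr_sum_single[of u n v \<phi> u v "\<phi> Diag" "\<phi> (Up 0)"] z(2) zu uv(3) 0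
    by (simp add: up_sum_def)
next
  case (Suc m)
  have uvV: "u \<in> V" "v \<in> V" using uv in_V by auto
  obtain q where q: "adj q z" "d u q = m" using gdist_pred[OF uvV(1) z(1)] j Suc by metis
  have "d v q = j"
    using gdist_adj_cases'[OF adj_verts(1)[OF q(1)] uv(3)] gdist_adj_cases[OF uvV(2) q(1)] q j Suc by linarith
  then have "ecol u v z q = Up m"
    by (intro ecol_Up) (use q j Suc uvV gdist_self[of u] in \<open>auto simp: doubleton_eq_iff\<close>)
  moreover have "ecol u v z w = Up j" if w: "adj z w" "w \<noteq> q" for w
  proof (rule ecol_Up)
    have "d u w \<noteq> m"
      using pred_unique[OF uvV(1) q(1) adj_sym[OF w(1)], of m] w q j Suc by auto
    then show "d u w = j + 1" using gdist_adj_cases[OF uvV(1) w(1)] j Suc by auto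
    show "{z, w} \<noteq> {u, v}" using j Suc gdist_self uvV by (auto simp: doubleton_eq_iff)
  qed (use j in auto)
  ultimately show ?thesis
    using nbr_sum_single[of z n q \<phi> u v "\<phi> (Up m)" "\<phi> (Up j)"] z(2) adj_sym[OF q(1)] Suc
    by (simp add: up_sum_def)
qed

lemma nbr_sum_down:
  assumes uv: "u \<in> A" "v \<in> B" "adj u v" and z: "z \<in> V" "card {w. adj z w} = Suc n"
    and j: "d v z = j" "d u z = j + 1" "j \<le> 2 * r + 1"
  shows "nbr_sum \<phi> u v z = down_sum n \<phi> j"
proof -
  have uvV: "u \<in> V" "v \<in> V" using uv in_V by auto
  have far_nbr: "ecol u v z w = Down j" if "d u w = j + 2" for w
    using ecol_Down(1)[OF uvV, of z j w] that j by simp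
  have near_nbr: "ecol u v z w = Down (j - 1)" if "d v w = j - 1" "d u w = j" "0 < j" for w
    using ecol_Down(2)[OF uvV, of w "j - 1" z] that j by simp
  consider "j = 0" | "0 < j" "j \<le> 2 * r" | "j = 2 * r + 1" using j by linarith
  then show ?thesis
  proof cases
    case 1
    then have zv: "z = v" using j gdist_eq_0_iff[OF uvV(2) z(1)] by simp
    have "ecol u v v u = Diag" by (simp add: ecol_def insert_commute)
    moreover have "ecol u v v w = Down 0" if w: "adj v w" "w \<noteq> u" for w
    proof -
      have "d u w \<noteq> 0" using w gdist_eq_0_iff[OF uvV(1) adj_verts(2)[OF w(1)]] by simp
      then have "d u w = 2" using gdist_adj_cases[OF uvV(1) w(1)] j 1 zv by auto
      then show ?thesis using far_nbr[of w] 1 zv by simp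
    qed
    ultimately show ?thesis
      unfolding zv using nbr_sum_single[of v n u \<phi> u v "\<phi> Diag" "\<phi> (Down 0)"] z(2) zv adj_sym[OF uv(3)] 1
      by (simp add: down_sum_def)
  next
    case 2
    obtain q where q: "adj q z" "d v q = j - 1"
      using gdist_pred[OF uvV(2) z(1), of "j - 1"] j 2 by auto
    have uq: "d u q = j"
      using gdist_adj_cases'[OF adj_verts(1)[OF q(1)] uv(3)] gdist_adj_cases[OF uvV(1) q(1)] q j 2 by linarith
    have cq: "ecol u v z q = Down (j - 1)" using near_nbr q uq 2 by simp
    show ?thesis
    proof (cases "j = 2 * r")
      case False
      have "ecol u v z w = Down j" if w: "adj z w" "w \<noteq> q" for w
      proof -
        have "d u w \<noteq> j"
          using pred_unique[OF uvV(1) q(1) adj_sym[OF w(1)], of j] w uq j 2 False by auto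
        then show ?thesis using far_nbr gdist_adj_cases[OF uvV(1) w(1)] j by auto
      qed
      then show ?thesis
        using nbr_sum_single[of z n q \<phi> u v "\<phi> (Down (j - 1))" "\<phi> (Down j)"] z(2) adj_sym[OF q(1)] cq 2 False
        by (simp add: down_sum_def)
    next
      case True
      \<comment> \<open>At distance 2r+1 from \<open>u\<close> uniqueness fails, but
        \<open>z\<close> has distance only 2r from \<open>v\<close>, where
        \<open>pred_unique\<close> still applies. Thus \<open>q\<close> is the only member of
        \<open>?P\<close> nearer to \<open>v\<close>, and the remaining ones recede from
        \<open>v\<close> while approaching \<open>u\<close>.\<close>
      let ?N = "{w. adj z w}" and ?P = "{w. adj z w \<and> d u w = 2 * r}"
      have P: "card ?P = c" using preds_A[OF uv(1) z(1)] j True by simp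
      have qP: "q \<in> ?P" using adj_sym[OF q(1)] uq True by simp
      have fin: "finite ?N" "finite ?P" using finite_nbrs finite_subset[OF _ finite_nbrs[of z], of ?P] by auto
      have c1: "1 \<le> c" using P qP fin by (metis One_nat_def Suc_leI card_gt_0_iff empty_iff)
      have cn: "c \<le> Suc n" using card_mono[OF fin(1), of ?P] P z(2) by auto
      have up: "ecol u v z w = Up (2 * r)" if w: "w \<in> ?P - {q}" for w
      proof -
        have w': "adj w z" "d u w = 2 * r" "w \<noteq> q" using w adj_sym by auto
        have "d v w \<noteq> 2 * r - 1"
          using pred_unique[OF uvV(2) w'(1) q(1), of "2 * r - 1"] w' q j True r_pos by auto
        then have "d v w = 2 * r + 1"
          using gdist_adj_cases[OF uvV(2) w'(1)] j True by auto
        then show ?thesis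
          by (intro ecol_Up) (use w' j True r_pos gdist_self uvV in \<open>auto simp: doubleton_eq_iff\<close>)
      qed
      have down: "ecol u v z w = Down (2 * r)" if w: "w \<in> ?N - ?P" for w
        using far_nbr[of w] gdist_adj_cases[OF uvV(1), of z w] w j True by auto
      have "nbr_sum \<phi> u v z = (\<Sum>w\<in>?N - ?P. \<phi> (ecol u v z w)) + (\<Sum>w\<in>?P. \<phi> (ecol u v z w))"
        unfolding nbr_sum_def by (rule sum.subset_diff) (use fin in auto)
      also have "(\<Sum>w\<in>?P. \<phi> (ecol u v z w)) = \<phi> (ecol u v z q) + (\<Sum>w\<in>?P - {q}. \<phi> (ecol u v z w))"
        by (rule sum.remove[OF fin(2) qP])
      also have "(\<Sum>w\<in>?P - {q}. \<phi> (ecol u v z w)) = (\<Sum>w\<in>?P - {q}. \<phi> (Up (2 * r)))"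
        by (rule sum.cong) (use up in auto)
      also have "\<dots> = (int c - 1) * \<phi> (Up (2 * r))"
        using P qP fin c1 by (simp add: card_Diff_singleton of_nat_diff)
      also have "(\<Sum>w\<in>?N - ?P. \<phi> (ecol u v z w)) = (\<Sum>w\<in>?N - ?P. \<phi> (Down (2 * r)))"
        by (rule sum.cong) (use down in auto)
      also have "\<dots> = int (card (?N - ?P)) * \<phi> (Down (2 * r))" by simp
      also have "card (?N - ?P) = Suc n - c"
        using card_Diff_subset[OF fin(2), of ?N] P z(2) by auto
      also have "int (Suc n - c) = int n + 1 - int c" using cn by simp
      finally show ?thesis using cq True r_pos by (simp add: down_sum_def)
    qed
  next
    case 3
    have "ecol u v z w = Down (2 * r)" if w: "adj z w" for w
    proof -
      have wV: "w \<in> V" using w adj_verts by auto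
      have "d u w = j" using gdist_adj_cases[OF uvV(1) w] gdist_le_diam[OF uvV(1) wV] j 3 by auto
      moreover have "d v w = j - 1"
        using gdist_adj_cases[OF uvV(2) w] gdist_B_le[OF uv(2) wV] j 3 by auto
      ultimately show ?thesis using near_nbr[of w] 3 by simp
    qed
    then have "nbr_sum \<phi> u v z = (\<Sum>w\<in>{w. adj z w}. \<phi> (Down (2 * r)))"
      unfolding nbr_sum_def by (intro sum.cong) auto
    then show ?thesis using z(2) 3 by (simp add: down_sum_def)
  qed
qed

text \<open>\<open>A_sum\<close> and \<open>B_sum\<close> read off, from the colour of an edge, which of the two kinds of sums
  arises at its end in \<open>A\<close> and in \<open>B\<close>: the parity of \<open>i\<close> tells which end is the nearer one.\<close>

definition A_sum :: "(colour \<Rightarrow> int) \<Rightarrow> colour \<Rightarrow> int" where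
  "A_sum \<phi> s = (case s of Diag \<Rightarrow> up_sum k \<phi> 0
     | Up i \<Rightarrow> up_sum k \<phi> (if even i then i else i + 1)
     | Down i \<Rightarrow> down_sum k \<phi> (if odd i then i else i + 1))"

definition B_sum :: "(colour \<Rightarrow> int) \<Rightarrow> colour \<Rightarrow> int" where
  "B_sum \<phi> s = (case s of Diag \<Rightarrow> down_sum l \<phi> 0
     | Up i \<Rightarrow> if odd i then up_sum l \<phi> i
         else if i = 2 * r then down_sum l \<phi> i else up_sum l \<phi> (i + 1)
     | Down i \<Rightarrow> down_sum l \<phi> (if even i then i else i + 1))"

lemma nbr_sum_A:
  assumes uv: "u \<in> A" "v \<in> B" "adj u v" and xy: "x \<in> A" "adj x y"
  shows "nbr_sum \<phi> u v x = A_sum \<phi> (ecol u v x y)"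
  using uv xy(2)
proof (cases rule: ecol_cases)
  case Diag
  then have "x = u" using xy uv AB by (auto simp: doubleton_eq_iff)
  then show ?thesis using nbr_sum_up[OF uv, of u k 0 \<phi>] Diag deg_A uv in_V gdist_adj[OF adj_sym[OF uv(3)]]
    by (simp add: A_sum_def)
next
  case (Up z w i)
  have x: "even (d u x)" using even_gdist[of u x] uv xy in_V by simp
  show ?thesis
  proof (cases "even i")
    case True
    then have "x = z" using x Up by (auto simp: doubleton_eq_iff)
    then show ?thesis using nbr_sum_up[OF uv, of x k i \<phi>] Up deg_A xy in_V True
      by (simp add: A_sum_def)
  next
    case False
    \<comment> \<open>An odd \<open>i\<close> cannot be the exceptional index 2r, so the distance
      from \<open>v\<close> is \<open>i + 2\<close>.\<close>
    then have "x = w" "i < 2 * r" using x Up by (auto simp: doubleton_eq_iff le_less)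
    then show ?thesis using nbr_sum_up[OF uv, of x k "i + 1" \<phi>] Up deg_A xy in_V False
      by (simp add: A_sum_def)
  qed
next
  case (Down z w i)
  have x: "even (d u x)" using even_gdist[of u x] uv xy in_V by simp
  show ?thesis
  proof (cases "even i")
    case False
    then have "x = z" using x Down by (auto simp: doubleton_eq_iff)
    then show ?thesis using nbr_sum_down[OF uv, of x k i \<phi>] Down deg_A xy in_V False
      by (simp add: A_sum_def)
  next
    case True
    then have "x = w" using x Down by (auto simp: doubleton_eq_iff)
    then show ?thesis using nbr_sum_down[OF uv, of x k "i + 1" \<phi>] Down deg_A xy in_V True
      by (simp add: A_sum_def)
  qed
qed

lemma nbr_sum_B:
  assumes uv: "u \<in> A" "v \<in> B" "adj u v" and xy: "x \<in> B" "adj x y"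
  shows "nbr_sum \<phi> u v x = B_sum \<phi> (ecol u v x y)"
  using uv xy(2)
proof (cases rule: ecol_cases)
  case Diag
  then have "x = v" using xy uv AB by (auto simp: doubleton_eq_iff)
  then show ?thesis using nbr_sum_down[OF uv, of v l 0 \<phi>] Diag deg_B uv in_V gdist_adj[OF uv(3)]
    by (simp add: B_sum_def)
next
  case (Up z w i)
  have x: "odd (d u x)" using even_gdist[of u x] uv xy in_V AB(2) by blast
  show ?thesis
  proof (cases "odd i")
    case True
    then have "x = z" using x Up by (auto simp: doubleton_eq_iff)
    then show ?thesis using nbr_sum_up[OF uv, of x l i \<phi>] Up deg_B xy in_V True
      by (simp add: B_sum_def)
  next
    case False
    then have xw: "x = w" using x Up by (auto simp: doubleton_eq_iff)
    show ?thesis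
    proof (cases "i = 2 * r")
      case True
      \<comment> \<open>The end \<open>x\<close> is nearer to \<open>v\<close> than to
        \<open>u\<close>, although the edge has a colour \<open>Up\<close>; this is where the two
        kinds of sums mix.\<close>
      then show ?thesis using nbr_sum_down[OF uv, of x l i \<phi>] Up deg_B xy in_V xw
        by (simp add: B_sum_def)
    next
      case i: False
      then show ?thesis using nbr_sum_up[OF uv, of x l "i + 1" \<phi>] Up deg_B xy in_V xw False
        by (simp add: B_sum_def)
    qed
  qed
next
  case (Down z w i)
  have x: "odd (d u x)" using even_gdist[of u x] uv xy in_V AB(2) by blast
  show ?thesis
  proof (cases "even i")
    case True
    then have "x = z" using x Down by (auto simp: doubleton_eq_iff)
    then show ?thesis using nbr_sum_down[OF uv, of x l i \<phi>] Down deg_B xy in_V True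
      by (simp add: B_sum_def)
  next
    case False
    then have "x = w" using x Down by (auto simp: doubleton_eq_iff)
    then show ?thesis using nbr_sum_down[OF uv, of x l "i + 1" \<phi>] Down deg_B xy in_V False
      by (simp add: B_sum_def)
  qed
qed

subsection \<open>The scheme\<close>

definition E :: "('a \<times> 'a) set" where
  "E = {(x, y). adj x y \<and> x \<in> A \<and> y \<in> B}"

definition col :: "'a \<times> 'a \<Rightarrow> 'a \<times> 'a \<Rightarrow> colour" where
  "col e f = ecol (fst e) (snd e) (fst f) (snd f)"

definition colours :: "colour set" where
  "colours = {Diag} \<union> Up ` {0..2 * r} \<union> Down ` {0..2 * r}"

lemma in_E: "(x, y) \<in> E \<longleftrightarrow> adj x y \<and> x \<in> A \<and> y \<in> B"
  by (simp add: E_def)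

lemma col_colours: "e \<in> E \<Longrightarrow> f \<in> E \<Longrightarrow> col e f \<in> colours"
proof (cases e, cases f)
  fix u v x y assume "e \<in> E" "f \<in> E" "e = (u, v)" "f = (x, y)"
  then have h: "u \<in> A" "v \<in> B" "adj u v" "adj x y" by (auto simp: in_E)
  show "col e f \<in> colours"
    by (rule ecol_cases[OF h]) (auto simp: col_def colours_def \<open>e = _\<close> \<open>f = _\<close>)
qed

lemma edge_pair_eq:
  assumes "(u, v) \<in> E" "(x, y) \<in> E"
  shows "{x, y} = {u, v} \<longleftrightarrow> x = u \<and> y = v"
  using assms AB(2) by (auto simp: in_E doubleton_eq_iff)

lemma ecol_eq_Diag_iff: "ecol u v x y = Diag \<longleftrightarrow> {x, y} = {u, v}"
  by (simp add: ecol_def Let_def)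

sublocale colouring E col Diag
proof
  show "finite E" using finite_subset[OF _ pair_finite_arcs, of E] by (auto simp: E_def)
  show "col e f = Diag \<longleftrightarrow> e = f" if "e \<in> E" "f \<in> E" for e f
    using that edge_pair_eq[of "fst e" "snd e" "fst f" "snd f"]
    by (auto simp: col_def ecol_eq_Diag_iff prod_eq_iff)
qed

lemma same_A_iff:
  assumes "e \<in> E" "f \<in> E"
  shows "col e f \<in> {Diag, Up 0} \<longleftrightarrow> fst e = fst f"
proof -
  obtain u v x y where ef: "e = (u, v)" "f = (x, y)" by force
  have h: "u \<in> A" "v \<in> B" "adj u v" "adj x y" "x \<in> A" "y \<in> B" using assms ef by (auto simp: in_E)
  have V: "u \<in> V" "v \<in> V" "x \<in> V" "y \<in> V" using h in_V by auto
  have "ecol u v x y \<in> {Diag, Up 0} \<longleftrightarrow> u = x"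
  proof
    assume "ecol u v x y \<in> {Diag, Up 0}"
    with h(1-4) show "u = x"
    proof (cases rule: ecol_cases)
      case Diag
      then show ?thesis using edge_pair_eq[of u v x y] assms ef by simp
    next
      case (Up z w i)
      then have "u = z" using \<open>ecol u v x y \<in> {Diag, Up 0}\<close> gdist_eq_0_iff[OF V(1) adj_verts(1)[OF Up(2)]] by simp
      then show ?thesis using Up(1) h AB(2) by (auto simp: doubleton_eq_iff)
    qed simp
  next
    assume ux: "u = x"
    show "ecol u v x y \<in> {Diag, Up 0}"
    proof (cases "y = v")
      case True
      then show ?thesis using ux by (simp add: ecol_def)
    next
      case False
      have "ecol u v x y = Up 0"
      proof (rule ecol_Up)
        show "d u x = 0" using ux V by simp
        show "d v x = 0 + 1" using gdist_adj[OF adj_sym[OF h(3)]] ux by simp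
        show "d u y = 0 + 1" using gdist_adj[OF h(4)] ux by simp
        show "{x, y} \<noteq> {u, v}" using False ux by (auto simp: doubleton_eq_iff)
      qed
      then show ?thesis by simp
    qed
  qed
  then show ?thesis using ef by (simp add: col_def)
qed

lemma same_B_iff:
  assumes "e \<in> E" "f \<in> E"
  shows "col e f \<in> {Diag, Down 0} \<longleftrightarrow> snd e = snd f"
proof -
  obtain u v x y where ef: "e = (u, v)" "f = (x, y)" by force
  have h: "u \<in> A" "v \<in> B" "adj u v" "adj x y" "x \<in> A" "y \<in> B" using assms ef by (auto simp: in_E)
  have V: "u \<in> V" "v \<in> V" "x \<in> V" "y \<in> V" using h in_V by auto
  have "ecol u v x y \<in> {Diag, Down 0} \<longleftrightarrow> v = y"
  proof
    assume "ecol u v x y \<in> {Diag, Down 0}"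
    with h(1-4) show "v = y"
    proof (cases rule: ecol_cases)
      case Diag
      then show ?thesis using edge_pair_eq[of u v x y] assms ef by simp
    next
      case (Down z w i)
      then have "v = z" using \<open>ecol u v x y \<in> {Diag, Down 0}\<close> gdist_eq_0_iff[OF V(2) adj_verts(1)[OF Down(2)]] by simp
      then show ?thesis using Down(1) h AB(2) by (auto simp: doubleton_eq_iff)
    qed simp
  next
    assume vy: "v = y"
    show "ecol u v x y \<in> {Diag, Down 0}"
    proof (cases "x = u")
      case True
      then show ?thesis using vy by (simp add: ecol_def)
    next
      case False
      have "ecol u v x y = Down 0"
      proof (rule ecol_Down(2)[OF V(1,2)])
        show "d v y = 0" using vy V by simp
        show uy: "d u y = 0 + 1" using gdist_adj[OF h(3)] vy by simp
        show "d u x = 0 + 2"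
          using gdist_adj_cases[OF V(1) h(4)] uy False gdist_eq_0_iff[OF V(1,3)] by auto
      qed
      then show ?thesis by simp
    qed
  qed
  then show ?thesis using ef by (simp add: col_def)
qed

section \<open>Generation by the two relations of sharing an end\<close>

definition same_A :: "colour \<Rightarrow> int" where "same_A s = of_bool (s \<in> {Diag, Up 0})"
definition same_B :: "colour \<Rightarrow> int" where "same_B s = of_bool (s \<in> {Diag, Down 0})"

text \<open>The factor restricts the sum to the edges with the same end in \<open>A\<close> as
  \<open>f\<close>, so right multiplication by this matrix becomes \<open>nbr_sum\<close> at that
  end.\<close>

lemma sum_same_A:
  assumes "e \<in> E" "f \<in> E"
  shows "(\<Sum>g\<in>E. \<phi> (col e g) * same_A (col g f)) = A_sum \<phi> (col e f)"
proof -
  obtain u v x y where ef: "e = (u, v)" "f = (x, y)" by force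
  have h: "u \<in> A" "v \<in> B" "adj u v" "x \<in> A" "adj x y" using assms ef by (auto simp: in_E)
  have "(\<Sum>g\<in>E. \<phi> (col e g) * same_A (col g f)) = (\<Sum>g\<in>E. if fst g = x then \<phi> (col e g) else 0)"
    by (rule sum.cong) (use same_A_iff assms ef in \<open>auto simp: same_A_def\<close>)
  also have "\<dots> = (\<Sum>g\<in>{g \<in> E. fst g = x}. \<phi> (col e g))"
    using finite_points by (simp add: sum.inter_filter)
  also have "{g \<in> E. fst g = x} = Pair x ` {w. adj x w}"
    using h(4) adj_classes AB(2) by (auto simp: E_def)
  also have "(\<Sum>g\<in>Pair x ` {w. adj x w}. \<phi> (col e g)) = nbr_sum \<phi> u v x"
    unfolding nbr_sum_def by (subst sum.reindex) (auto simp: inj_on_def col_def ef)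
  also have "\<dots> = A_sum \<phi> (col e f)" using nbr_sum_A[OF h] ef by (simp add: col_def)
  finally show ?thesis .
qed

lemma ecol_swap: "adj x y \<Longrightarrow> u \<in> V \<Longrightarrow> ecol u v x y = ecol u v y x"
  using gdist_adj_cases[of u x y] by (auto simp: ecol_def insert_commute)

lemma sum_same_B:
  assumes "e \<in> E" "f \<in> E"
  shows "(\<Sum>g\<in>E. \<phi> (col e g) * same_B (col g f)) = B_sum \<phi> (col e f)"
proof -
  obtain u v x y where ef: "e = (u, v)" "f = (x, y)" by force
  have h: "u \<in> A" "v \<in> B" "adj u v" "y \<in> B" "adj y x" using assms ef adj_sym by (auto simp: in_E)
  have uV: "u \<in> V" using h in_V by auto
  have "(\<Sum>g\<in>E. \<phi> (col e g) * same_B (col g f)) = (\<Sum>g\<in>E. if snd g = y then \<phi> (col e g) else 0)"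
    by (rule sum.cong) (use same_B_iff assms ef in \<open>auto simp: same_B_def\<close>)
  also have "\<dots> = (\<Sum>g\<in>{g \<in> E. snd g = y}. \<phi> (col e g))"
    using finite_points by (simp add: sum.inter_filter)
  also have "{g \<in> E. snd g = y} = (\<lambda>w. (w, y)) ` {w. adj y w}"
    using h(4) adj_classes AB(2) adj_sym by (auto simp: E_def)
  also have "(\<Sum>g\<in>(\<lambda>w. (w, y)) ` {w. adj y w}. \<phi> (col e g)) = (\<Sum>w\<in>{w. adj y w}. \<phi> (ecol u v w y))"
    by (subst sum.reindex) (auto simp: inj_on_def col_def ef)
  also have "\<dots> = nbr_sum \<phi> u v y"
    unfolding nbr_sum_def by (rule sum.cong) (use ecol_swap[OF _ uV] in auto)
  also have "\<dots> = B_sum \<phi> (col e f)" using nbr_sum_B[OF h] ecol_swap[OF h(5) uV] ef by (simp add: col_def)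
  finally show ?thesis .
qed

lemma compatible_same_A: "compatible same_A"
  unfolding compatible_def using sum_same_A by blast

lemma compatible_same_B: "compatible same_B"
  unfolding compatible_def using sum_same_B by blast

lemma compatible_step_A:
  assumes "compatible w1" "compatible w2" "\<And>s. s \<in> colours \<Longrightarrow> w s = A_sum w1 s - w2 s"
  shows "compatible w"
  by (rule compatible_mult_diff[OF assms(1) compatible_same_A assms(2)])
    (simp add: sum_same_A assms(3) col_colours)

lemma compatible_step_B:
  assumes "compatible w1" "compatible w2" "\<And>s. s \<in> colours \<Longrightarrow> w s = B_sum w1 s - w2 s"
  shows "compatible w"
  by (rule compatible_mult_diff[OF assms(1) compatible_same_B assms(2)])
    (simp add: sum_same_B assms(3) col_colours)

text \<open>The end farther from \<open>u\<close> of an edge in \<open>Up j\<close> lies in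
  \<open>B\<close> for even \<open>j\<close> and in \<open>A\<close> for odd \<open>j\<close>; this
  decides which generator moves on to \<open>Up (Suc j)\<close>.\<close>

lemma compatible_Up: "j \<le> 2 * r \<Longrightarrow> compatible (ind (Up j))"
proof (induction j)
  case 0
  show ?case
    by (rule compatible_step_A[OF compatible_ind_diag compatible_ind_diag])
      (auto simp: colours_def A_sum_def ind_def up_sum_def down_sum_def odd_pos split: if_splits)
next
  case (Suc j)
  then have IH: "compatible (ind (Up j))" by simp
  show ?case
  proof (cases "even j")
    case True
    show ?thesis
      by (rule compatible_step_B[OF IH IH])
        (use True Suc.prems r_pos in \<open>auto simp: colours_def B_sum_def ind_def up_sum_def down_sum_def of_bool_def odd_pos split: if_splits\<close>)
  next
    case False
    show ?thesis
      by (rule compatible_step_A[OF IH IH])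
        (use False Suc.prems r_pos in \<open>auto simp: colours_def A_sum_def ind_def up_sum_def down_sum_def of_bool_def odd_pos split: if_splits\<close>)
  qed
qed

text \<open>Here the index is the distance from \<open>v\<close>, which lies in \<open>B\<close>, so
  the generators alternate the other way round. At \<open>Suc j = 2 * r\<close> the extra summand
  \<open>ind (Up (2 * r))\<close> must be subtracted, so \<open>compatible_Up\<close> has to come
  first.\<close>

lemma compatible_Down: "j \<le> 2 * r \<Longrightarrow> compatible (ind (Down j))"
proof (induction j)
  case 0
  show ?case
    by (rule compatible_step_B[OF compatible_ind_diag compatible_ind_diag])
      (use r_pos in \<open>auto simp: colours_def B_sum_def ind_def up_sum_def down_sum_def odd_pos split: if_splits\<close>)
next
  case (Suc j)
  then have IH: "compatible (ind (Down j))" by simp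
  consider "even j" | "odd j" "Suc j < 2 * r" | "odd j" "Suc j = 2 * r" using Suc.prems by linarith
  then show ?case
  proof cases
    case 1
    show ?thesis
      by (rule compatible_step_A[OF IH IH])
        (use 1 Suc.prems r_pos in \<open>auto simp: colours_def A_sum_def ind_def up_sum_def down_sum_def of_bool_def odd_pos split: if_splits\<close>)
  next
    case 2
    show ?thesis
      by (rule compatible_step_B[OF IH IH])
        (use 2 Suc.prems r_pos in \<open>auto simp: colours_def B_sum_def ind_def up_sum_def down_sum_def of_bool_def odd_pos split: if_splits\<close>)
  next
    case 3
    show ?thesis
      by (rule compatible_step_B[OF IH compatible_add[OF IH compatible_Up[of "2 * r"]]],
          insert 3 Suc.prems r_pos,
          auto simp: colours_def B_sum_def ind_def up_sum_def down_sum_def of_bool_def split: if_splits)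
        presburger+
  qed
qed

lemma compatible_ind: "s \<in> colours \<Longrightarrow> compatible (ind s)"
  using compatible_ind_diag compatible_Up compatible_Down by (auto simp: colours_def)

section \<open>Transposed relations\<close>

definition tr :: "colour \<Rightarrow> colour" where
  "tr s = (case s of Diag \<Rightarrow> Diag | Up i \<Rightarrow> if even i then Up i else Down i
     | Down i \<Rightarrow> if even i then Down i else Up i)"

text \<open>The parity of \<open>i\<close> tells whether the end of \<open>f\<close> nearer to
  \<open>u\<close> lies in \<open>A\<close> or in \<open>B\<close>. Reading the same four distances
  from \<open>f\<close> keeps the colour for even \<open>i\<close> and exchanges \<open>Up i\<close>
  and \<open>Down i\<close> for odd \<open>i\<close>.\<close>

lemma col_transpose:
  assumes "e \<in> E" "f \<in> E"
  shows "col f e = tr (col e f)"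
proof -
  obtain u v x y where ef: "e = (u, v)" "f = (x, y)" by force
  have h: "u \<in> A" "v \<in> B" "adj u v" "adj x y" "x \<in> A" "y \<in> B" using assms ef by (auto simp: in_E)
  have V: "u \<in> V" "v \<in> V" "x \<in> V" "y \<in> V" using h in_V by auto
  have evx: "even (d u x)" using even_gdist[OF V(1,3)] h by simp
  have ody: "odd (d u y)" using even_gdist[OF V(1,4)] h AB(2) by blast
  have sym: "d x u = d u x" "d x v = d v x" "d y u = d u y" "d y v = d v y"
    using gdist_commute V by auto
  have "ecol x y u v = tr (ecol u v x y)"
    using h(1-4)
  proof (cases rule: ecol_cases)
    case Diag
    then show ?thesis by (simp add: tr_def ecol_def insert_commute)
  next
    case (Up z w i)
    have neq: "{u, v} \<noteq> {x, y}" using Up by simp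
    show ?thesis
    proof (cases "even i")
      case True
      then have zw: "z = x" "w = y" using Up(1,4,6) evx by (auto simp: doubleton_eq_iff)
      have "ecol x y u v = Up i" by (rule ecol_Up(1)) (use Up zw sym neq in auto)
      then show ?thesis using Up True by (simp add: tr_def)
    next
      case False
      then have zw: "z = y" "w = x" using Up(1,4,6) evx by (auto simp: doubleton_eq_iff)
      have "i \<noteq> 2 * r" using False by auto
      then have "ecol x y u v = Down i"
        by (intro ecol_Down(1)[OF V(3,4)]) (use Up zw sym in auto)
      then show ?thesis using Up False by (simp add: tr_def)
    qed
  next
    case (Down z w i)
    show ?thesis
    proof (cases "even i")
      case True
      then have zw: "z = y" "w = x" using Down(1,5,6) evx by (auto simp: doubleton_eq_iff)
      have "ecol x y u v = Down i"
        by (rule ecol_Down(2)[OF V(3,4)]) (use Down zw sym in auto)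
      then show ?thesis using Down True by (simp add: tr_def)
    next
      case False
      then have zw: "z = x" "w = y" using Down(1,5,6) evx by (auto simp: doubleton_eq_iff)
      have "{v, u} \<noteq> {x, y}" using Down V zw by (auto simp: doubleton_eq_iff)
      moreover have "d v x = i" "d u x = i + 1" "d v y = i + 1" using Down(4,5,7) zw by simp_all
      ultimately have "ecol x y u v = Up i" by (intro ecol_Up(2)) (simp_all add: sym)
      then show ?thesis using Down False by (simp add: tr_def)
    qed
  qed
  then show ?thesis using ef by (simp add: col_def)
qed

section \<open>Occurrence of every colour\<close>

lemma orient:
  assumes "adj x y"
  obtains f where "f \<in> E" "{fst f, snd f} = {x, y}"
    "\<And>u v. u \<in> V \<Longrightarrow> ecol u v (fst f) (snd f) = ecol u v x y"
proof (cases "x \<in> A")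
  case True
  then show thesis using that[of "(x, y)"] assms adj_classes[OF assms] AB(2) by (auto simp: in_E)
next
  case False
  then show thesis
    using that[of "(y, x)"] assms adj_classes[OF assms] adj_sym[OF assms] ecol_swap[OF assms]
    by (auto simp: in_E)
qed

lemma col_attained:
  assumes "u \<in> A" "v \<in> B" "adj u v" "adj x y" "ecol u v x y = s"
  shows "\<exists>e\<in>E. \<exists>f\<in>E. col e f = s"
proof -
  obtain f where "f \<in> E" "ecol u v (fst f) (snd f) = ecol u v x y"
    using orient[OF assms(4)] in_V(1)[OF assms(1)] by metis
  then show ?thesis
    using assms by (intro bexI[of _ "(u, v)"] bexI[of _ f]) (auto simp: col_def in_E)
qed

text \<open>The first step that fails to increase the distance from \<open>z m\<close> would give
  the vertex before it two nearer neighbours, which are distinct because the walk does not turn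
  back.\<close>

lemma nonbacktracking_geodesic:
  assumes adj: "\<And>i. adj (z i) (z (Suc i))" and nb: "\<And>i. z i \<noteq> z (Suc (Suc i))"
    and "n \<le> 2 * r + 1"
  shows "d (z m) (z (m + n)) = n"
proof -
  have V: "z i \<in> V" for i using adj_verts(1)[OF adj] .
  have "n \<le> 2 * r \<Longrightarrow> d (z m) (z (m + n)) = n \<and> d (z m) (z (Suc (m + n))) = Suc n" for n
  proof (induction n)
    case 0
    then show ?case using V gdist_adj[OF adj] by simp
  next
    case (Suc n)
    then have IH: "d (z m) (z (m + n)) = n" "d (z m) (z (Suc (m + n))) = Suc n" by auto
    have "d (z m) (z (Suc (Suc (m + n)))) \<noteq> n"
      using pred_unique[OF V adj adj_sym[OF adj] IH(2,1)] nb[of "m + n"] Suc.prems by auto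
    then show ?case using gdist_adj_cases[OF V[of m] adj[of "Suc (m + n)"]] IH by auto
  qed
  then show ?thesis using assms(3) V
    by (cases n) (auto simp: le_Suc_eq)
qed

lemma all_colours_attained:
  assumes "s \<in> colours"
  shows "\<exists>e\<in>E. \<exists>f\<in>E. col e f = s"
proof -
  obtain u x where ux: "u \<in> A" "x \<in> V" "d u x = 2 * r + 2" using far by auto
  have uV: "u \<in> V" using ux in_V by auto
  obtain p where p: "p 0 = u" "p (2 * r + 2) = x" "\<And>i. i < 2 * r + 2 \<Longrightarrow> adj (p i) (p (Suc i))"
    "\<And>i. i \<le> 2 * r + 2 \<Longrightarrow> d u (p i) = i"
    using geodesic[OF uV ux(2,3)] by metis
  have pV: "p i \<in> V" if "i \<le> 2 * r + 2" for i
    using that p(3)[of i] adj_verts(1) p(2) ux(2) by (cases "i = 2 * r + 2") auto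
  have dp: "d (p i) (p j) = j - i" if "i \<le> j" "j \<le> 2 * r + 2" for i j
  proof -
    have "d (p i) (p j) \<le> j - i"
      by (rule gdist_geodesic_le[where z = p, OF p(3)]) (use that pV in auto)
    moreover have "d u (p j) \<le> d u (p i) + d (p i) (p j)"
      by (rule gdist_triangle) (use uV pV that in auto)
    ultimately show ?thesis using p(4)[of i] p(4)[of j] that by simp
  qed
  have p01: "adj (p 0) (p 1)" "adj (p 1) (p 2)" using p(3)[of 0] p(3)[of 1] by (auto simp: numeral_2_eq_2)
  have cl: "p 0 \<in> A" "p 1 \<in> B" "p 2 \<in> A"
    using ux(1) p(1) adj_classes[OF p01(1)] adj_classes[OF p01(2)] AB(2) by auto
  from assms consider "s = Diag" | i where "s = Up i" "i < 2 * r" | "s = Up (2 * r)"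
    | i where "s = Down i" "i \<le> 2 * r"
    by (auto simp: colours_def le_less)
  then show ?thesis
  proof cases
    case 1
    then show ?thesis using col_attained[OF cl(1,2) p01(1) p01(1)] by (simp add: ecol_def)
  next
    case (2 i)
    \<comment> \<open>The base edge is the second edge of the geodesic, so that its end
      \<open>p 2\<close> in \<open>A\<close> is the one nearer to the later vertices. Since
      \<open>p (i + 3)\<close> must lie on the geodesic, the index 2r is out of reach here.\<close>
    have "ecol (p 2) (p 1) (p (i + 2)) (p (i + 3)) = Up i"
      by (rule ecol_Up) (use dp[of 2 "i + 2"] dp[of 1 "i + 2"] dp[of 2 "i + 3"] dp[of 1 "i + 3"] 2 pV
          in \<open>auto simp: doubleton_eq_iff\<close>)
    moreover have "adj (p (i + 2)) (p (i + 3))" using p(3)[of "i + 2"] 2 by (simp add: numeral_3_eq_3)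
    ultimately show ?thesis using col_attained[OF cl(3,2) adj_sym[OF p01(2)]] 2 by blast
  next
    case (4 i)
    have "ecol (p 0) (p 1) (p (i + 1)) (p (i + 2)) = Down i"
      by (rule ecol_Down) (use dp[of 0 "i + 1"] dp[of 1 "i + 1"] dp[of 0 "i + 2"] 4 pV in auto)
    moreover have "adj (p (i + 1)) (p (i + 2))" using p(3)[of "i + 1"] 4 by simp
    ultimately show ?thesis using col_attained[OF cl(1,2) p01(1)] 4 by blast
  next
    case 3
    \<comment> \<open>For \<open>Up (2 * r)\<close> the second edge is the one opposite to the first
      on a shortest cycle.\<close>
    obtain z where z: "\<And>i. adj (z i) (z (Suc i))" "\<And>i. z (i + (4 * r + 2)) = z i"
      "inj_on z {..<4 * r + 2}"
      using girth_attained[OF girth_G] by metis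
    have zmod: "z (i mod (4 * r + 2)) = z i" for i
    proof (induction i rule: less_induct)
      case (less i)
      show ?case
      proof (cases "i < 4 * r + 2")
        case False
        then obtain j where "i = j + (4 * r + 2)" by (metis le_add_diff_inverse2 not_less)
        then show ?thesis using less[of j] z(2)[of j] by (simp only: mod_add_self2)
      qed simp
    qed
    have nb: "z i \<noteq> z (Suc (Suc i))" for i
    proof
      assume "z i = z (Suc (Suc i))"
      then have "z (i mod (4 * r + 2)) = z ((i + 2) mod (4 * r + 2))" by (simp only: zmod) simp
      then have "i mod (4 * r + 2) = (i + 2) mod (4 * r + 2)"
        by (rule inj_onD[OF z(3)]) auto
      then have "(4 * r + 2) dvd (i + 2 - i)" by (metis le_add1 mod_eq_dvd_iff_nat)
      then have "4 * r + 2 \<le> 2" by (intro dvd_imp_le) auto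
      then show False using r_pos by simp
    qed
    obtain m where m: "z m \<in> A"
      using adj_classes[OF z(1)[of 0]] by auto
    have geo: "d (z i) (z (i + n)) = n" if "n \<le> 2 * r + 1" for i n
      by (rule nonbacktracking_geodesic[of z, OF z(1) nb that])
    have V: "z i \<in> V" for i using adj_verts(1)[OF z(1)] .
    have v: "z (m + 1) \<in> B" using adj_classes[OF z(1)[of m]] m AB(2) by auto
    have "ecol (z m) (z (m + 1)) (z (m + 2 * r + 2)) (z (m + 2 * r + 1)) = Up (2 * r)"
    proof (rule ecol_Up)
      \<comment> \<open>Continuing around the cycle, another 2r steps lead back to
        \<open>z m\<close>, so this end is reached more quickly the other way round.\<close>
      have "d (z (m + 2 * r + 2)) (z (m + 2 * r + 2 + 2 * r)) = 2 * r" by (rule geo) simp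
      moreover have "z (m + 2 * r + 2 + 2 * r) = z m" using z(2)[of m] by (simp add: algebra_simps)
      ultimately show *: "d (z m) (z (m + 2 * r + 2)) = 2 * r" using gdist_commute V by metis
      show "d (z m) (z (m + 2 * r + 1)) = 2 * r + 1" using geo[of "2 * r + 1" m] by (simp add: algebra_simps)
      show "d (z (m + 1)) (z (m + 2 * r + 2)) = 2 * r + 1"
        using geo[of "2 * r + 1" "m + 1"] by (simp add: algebra_simps)
      show "{z (m + 2 * r + 2), z (m + 2 * r + 1)} \<noteq> {z m, z (m + 1)}"
        using * \<open>d (z m) (z (m + 2 * r + 1)) = 2 * r + 1\<close> V r_pos by (auto simp: doubleton_eq_iff)
    qed
    moreover have "adj (z (m + 2 * r + 2)) (z (m + 2 * r + 1))"
      using adj_sym[OF z(1)[of "m + 2 * r + 1"]] by simp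
    ultimately show ?thesis using col_attained[OF m v] z(1)[of m] 3 by simp
  qed
qed

section \<open>From ordered pairs to undirected edges\<close>

definition edge_of :: "'a \<times> 'a \<Rightarrow> 'a set" where
  "edge_of e = {fst e, snd e}"

lemma edges_eq: "edges G = edge_of ` E"
proof
  show "edges G \<subseteq> edge_of ` E"
  proof
    fix X assume "X \<in> edges G"
    then obtain x y where "X = {x, y}" "adj x y" by (auto simp: edges_def)
    then obtain f where "f \<in> E" "X = edge_of f" using orient[of x y] unfolding edge_of_def by metis
    then show "X \<in> edge_of ` E" by blast
  qed
next
  show "edge_of ` E \<subseteq> edges G" unfolding edges_def edge_of_def E_def by auto blast
qed

lemma inj_on_edge_of: "inj_on edge_of E"
proof (rule inj_onI)
  fix e f assume "e \<in> E" "f \<in> E" "edge_of e = edge_of f"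
  then show "e = f" using edge_pair_eq[of "fst f" "snd f" "fst e" "snd e"]
    by (auto simp: edge_of_def prod_eq_iff)
qed

definition rel :: "colour \<Rightarrow> ('a set \<times> 'a set) set" where
  "rel s = {(edge_of e, edge_of f) | e f. e \<in> E \<and> f \<in> E \<and> col e f = s}"

lemma relI:
  assumes "u \<in> A" "v \<in> B" "adj u v" "adj x y" "ecol u v x y = s"
  shows "({u, v}, {x, y}) \<in> rel s"
proof -
  obtain f where f: "f \<in> E" "{fst f, snd f} = {x, y}" "ecol u v (fst f) (snd f) = ecol u v x y"
    using orient[OF assms(4)] in_V(1)[OF assms(1)] by metis
  have "({u, v}, {x, y}) = (edge_of (u, v), edge_of f)" using f by (simp add: edge_of_def)
  moreover have "(u, v) \<in> E" "col (u, v) f = s" using assms f by (auto simp: in_E col_def)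
  ultimately show ?thesis using f(1) unfolding rel_def by blast
qed

lemma rel_Diag: "rel Diag = Id_on (edges G)"
proof
  show "rel Diag \<subseteq> Id_on (edges G)"
    using col_diag by (auto simp: rel_def edges_eq)
  show "Id_on (edges G) \<subseteq> rel Diag"
  proof
    fix X assume "X \<in> Id_on (edges G)"
    then obtain e where "e \<in> E" "X = (edge_of e, edge_of e)" by (auto simp: edges_eq)
    then show "X \<in> rel Diag" unfolding rel_def using col_diag[of e e] by blast
  qed
qed

lemma rel_Up: "rel (Up i) = R_up G A B i"
proof
  show "R_up G A B i \<subseteq> rel (Up i)"
  proof
    fix X assume "X \<in> R_up G A B i"
    then obtain u v x y where X: "X = ({u, v}, {x, y})" "adj u v" "u \<in> A" "v \<in> B" "adj x y"
      "{u, v} \<noteq> {x, y}" "d x u < d y u" "x \<in> dist_cell G i (i + 1) u v"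
      unfolding R_up_def by blast
    have V: "u \<in> V" "x \<in> V" "y \<in> V" using X in_V adj_verts by auto
    have "d u y = d u x + 1" using gdist_adj_cases[OF V(1) X(5)] X(7) gdist_commute[OF V(1)] V by auto
    then have "ecol u v x y = Up i"
      by (intro ecol_Up) (use X in \<open>auto simp: dist_cell_def sphere_def\<close>)
    then show "X \<in> rel (Up i)" using relI X by simp
  qed
  show "rel (Up i) \<subseteq> R_up G A B i"
  proof
    fix X assume "X \<in> rel (Up i)"
    then obtain u v x y where X: "X = ({u, v}, {x, y})" "(u, v) \<in> E" "(x, y) \<in> E" "ecol u v x y = Up i"
      by (auto simp: rel_def edge_of_def col_def)
    have h: "u \<in> A" "v \<in> B" "adj u v" "adj x y" using X by (auto simp: in_E)
    from h show "X \<in> R_up G A B i"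
    proof (cases rule: ecol_cases)
      case (Up z w j)
      have V: "u \<in> V" "z \<in> V" "w \<in> V" using h Up in_V adj_verts by auto
      have "j = i" using Up X by simp
      then have "z \<in> dist_cell G i (i + 1) u v" "d z u < d w u"
        using Up V gdist_commute[OF V(1)] by (auto simp: dist_cell_def sphere_def)
      moreover have "X = ({u, v}, {z, w})" "{u, v} \<noteq> {z, w}" using X Up by auto
      ultimately show ?thesis using h Up(2) unfolding R_up_def by blast
    qed (use X in auto)
  qed
qed

lemma rel_Down: "rel (Down i) = R_down G A B i"
proof
  show "R_down G A B i \<subseteq> rel (Down i)"
  proof
    fix X assume "X \<in> R_down G A B i"
    then obtain u v x y where X: "X = ({u, v}, {x, y})" "adj u v" "u \<in> A" "v \<in> B" "adj x y"
      "{u, v} \<noteq> {x, y}" "d x u < d y u" "x \<in> dist_cell G (i + 1) i u v"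
      unfolding R_down_def by blast
    have V: "u \<in> V" "v \<in> V" "x \<in> V" "y \<in> V" using X in_V adj_verts by auto
    have "d u y = d u x + 1" using gdist_adj_cases[OF V(1) X(5)] X(7) gdist_commute[OF V(1)] V by auto
    then have "ecol u v x y = Down i"
      by (intro ecol_Down V) (use X in \<open>auto simp: dist_cell_def sphere_def\<close>)
    then show "X \<in> rel (Down i)" using relI X by simp
  qed
  show "rel (Down i) \<subseteq> R_down G A B i"
  proof
    fix X assume "X \<in> rel (Down i)"
    then obtain u v x y where X: "X = ({u, v}, {x, y})" "(u, v) \<in> E" "(x, y) \<in> E" "ecol u v x y = Down i"
      by (auto simp: rel_def edge_of_def col_def)
    have h: "u \<in> A" "v \<in> B" "adj u v" "adj x y" using X by (auto simp: in_E)
    from h show "X \<in> R_down G A B i"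
    proof (cases rule: ecol_cases)
      case (Down z w j)
      have V: "u \<in> V" "z \<in> V" "w \<in> V" using h Down in_V adj_verts by auto
      have "j = i" using Down X by simp
      then have "z \<in> dist_cell G (i + 1) i u v" "d z u < d w u"
        using Down V gdist_commute[OF V(1)] by (auto simp: dist_cell_def sphere_def)
      moreover have "X = ({u, v}, {z, w})" using X Down by auto
      moreover have "{u, v} \<noteq> {z, w}" using X Down(1) ecol_eq_Diag_iff[of u v x y] by auto
      ultimately show ?thesis using h Down(2) unfolding R_down_def by blast
    qed (use X in auto)
  qed
qed

lemma edge_relations_eq:
  assumes "diameter G = 2 * r + 2"
  shows "edge_relations G A B = rel ` colours"
  using assms by (simp add: edge_relations_def colours_def image_Un image_image rel_Diag rel_Up rel_Down Un_assoc)

lemma card_colours: "card colours = 4 * r + 3"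
proof -
  have "card (Up ` {0..2 * r} \<union> Down ` {0..2 * r}) = (2 * r + 1) + (2 * r + 1)"
    by (subst card_Un_disjoint) (auto simp: card_image inj_on_def)
  moreover have "colours = insert Diag (Up ` {0..2 * r} \<union> Down ` {0..2 * r})"
    by (auto simp: colours_def)
  ultimately show ?thesis by (subst \<open>colours = _\<close>, subst card_insert_disjoint) auto
qed

lemma edge_scheme: "association_scheme (edges G) (rel ` colours)" "inj_on rel colours"
proof -
  have "Diag \<in> colours" by (simp add: colours_def)
  note * = association_scheme_of_colouring[OF inj_on_edge_of col_colours all_colours_attained
      col_transpose compatible_ind rel_def this]
  show "association_scheme (edges G) (rel ` colours)" "inj_on rel colours"
    using * edges_eq by simp_all
qed

end

section \<open>The scheme of an unbalanced distance-biregular graph\<close>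

theorem corollary3p10:
  fixes G :: "'a pair_pre_digraph" and A B :: "'a set" and d r k l :: nat
    and \<A> :: "('a set \<Rightarrow> 'a set \<Rightarrow> complex) set"
  assumes "distance_biregular G A B"
    and "unbalanced G A B"
    and "class_ecc G A > class_ecc G B"
    and "d = diameter G"
    and "d = 2 * r + 2"
    and "r \<ge> 1"
    and "girth_deficiency_two G"
    and "\<forall>u \<in> A. out_degree (with_proj G) u = k + 1"
    and "\<forall>v \<in> B. out_degree (with_proj G) v = l + 1"
    and "\<A> = cmat.span (adj_matrix ` edge_relations G A B)"
  shows "association_scheme (edges G) (edge_relations G A B)
    \<and> \<A> = adjacency_algebra (edge_relations G A B)
    \<and> cmat.dim \<A> = 2 * d - 1"
proof -
  interpret pair_graph G using assms(1) by (simp add: distance_biregular_def)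
  interpret bipartite_graph G A B
    using assms(1) by unfold_locales (auto simp: distance_biregular_def)
  have arrays: "\<exists>b c. \<forall>u\<in>C. \<forall>i\<le>ecc G u. \<forall>v\<in>sphere G i u.
      card (sphere G (i + 1) u \<inter> sphere G 1 v) = b i \<and> card (sphere G (i - 1) u \<inter> sphere G 1 v) = c i"
    if "C \<in> {A, B}" for C
    using assms(1) bspec[OF _ that] unfolding distance_biregular_def by blast
  obtain bA cA where bcA: "\<forall>u\<in>A. \<forall>i\<le>ecc G u. \<forall>v\<in>sphere G i u.
      card (sphere G (i + 1) u \<inter> sphere G 1 v) = bA i \<and> card (sphere G (i - 1) u \<inter> sphere G 1 v) = cA i"
    using arrays[of A] by blast
  obtain bB cB where bcB: "\<forall>u\<in>B. \<forall>i\<le>ecc G u. \<forall>v\<in>sphere G i u.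
      card (sphere G (i + 1) u \<inter> sphere G 1 v) = bB i \<and> card (sphere G (i - 1) u \<inter> sphere G 1 v) = cB i"
    using arrays[of B] by blast
  have eccA: "ecc G u = class_ecc G A" if "u \<in> A" for u
    by (rule class_ecc_eq[OF _ that, of bA]) (use in_V bcA in auto)
  have eccB: "ecc G u = class_ecc G B" if "u \<in> B" for u
    by (rule class_ecc_eq[OF _ that, of bB]) (use in_V bcB in auto)
  obtain u0 where u0: "u0 \<in> pverts G" "ecc G u0 = diameter G" using diameter_attained by metis
  \<comment> \<open>If \<open>u0\<close> were in \<open>B\<close>, then \<open>class_ecc G B\<close>
    would be the diameter, and no vertex of \<open>A\<close> could have a larger eccentricity. The
    neighbour \<open>z 1\<close> of \<open>u0\<close> shows that \<open>A\<close> is nonempty, so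
    that \<open>class_ecc G A\<close> really is the eccentricity of a vertex.\<close>
  have u0A: "u0 \<in> A"
  proof (rule ccontr)
    assume n: "u0 \<notin> A"
    then have "ecc G u0 = class_ecc G B" using eccB u0 AB by auto
    have "0 < ecc G u0" using u0 assms by simp
    obtain x where "x \<in> pverts G" "gdist G u0 x = ecc G u0" using ecc_attained[OF u0(1)] by metis
    then obtain z where "z 0 = u0" "\<And>i. i < ecc G u0 \<Longrightarrow> (z i, z (Suc i)) \<in> parcs G"
      using geodesic[OF u0(1)] by metis
    then have "(u0, z 1) \<in> parcs G" using \<open>0 < ecc G u0\<close> by (metis One_nat_def)
    then have "z 1 \<in> A" using adj_classes n by blast
    then have "class_ecc G A \<le> diameter G" using eccA ecc_le_diameter in_V by metis
    then show False using u0 \<open>ecc G u0 = class_ecc G B\<close> assms(3) by simp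
  qed
  have A_diam: "class_ecc G A = 2 * r + 2" using eccA[OF u0A] u0(2) assms(4,5) by simp
  have deg: "card {y. (x, y) \<in> parcs G} = out_degree (with_proj G) x" for x
  proof -
    have "out_arcs (with_proj G) x = Pair x ` {y. (x, y) \<in> parcs G}"
      by (auto simp: out_arcs_def)
    then show ?thesis unfolding out_degree_def by (simp add: card_image inj_on_def)
  qed
  \<comment> \<open>The index \<open>2 * r + 1\<close> is within the range of the array because
    vertices of \<open>A\<close> have eccentricity 2r+2; the girth is
    \<open>2 * d - 2 = 4 * r + 2\<close>.\<close>
  interpret deficient_graph G A B r k l "cA (2 * r + 1)"
  proof
    show "1 \<le> r" by fact
    show "gdist G x y \<le> 2 * r + 2" if "x \<in> pverts G" "y \<in> pverts G" for x y
      using gdist_le_ecc[OF that] ecc_le_diameter[OF that(1)] assms(4,5) by simp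
    show "gdist G v x \<le> 2 * r + 1" if "v \<in> B" "x \<in> pverts G" for v x
      using gdist_le_ecc[OF in_V(2)[OF that(1)] that(2)] eccB[OF that(1)] A_diam assms(3) by simp
    show "girth G = enat (4 * r + 2)"
      using assms(4,5,7) by (simp add: girth_deficiency_two_def)
    show "card {y. (x, y) \<in> parcs G} = Suc k" if "x \<in> A" for x using assms(8) deg that by simp
    show "card {y. (x, y) \<in> parcs G} = Suc l" if "x \<in> B" for x using assms(9) deg that by simp
    show "\<exists>u\<in>A. \<exists>x\<in>pverts G. gdist G u x = 2 * r + 2"
      using u0A u0 ecc_attained[OF u0(1)] assms(4,5) by metis
    fix u x assume ux: "u \<in> A" "x \<in> pverts G" "gdist G u x = 2 * r + 1"
    have "card (sphere G (2 * r) u \<inter> sphere G 1 x) = cA (2 * r + 1)"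
      using bcA ux eccA[OF ux(1)] A_diam by (auto simp: sphere_def dest!: bspec[of _ _ u] spec[of _ "2 * r + 1"])
    moreover have "sphere G (2 * r) u \<inter> sphere G 1 x = {y. (x, y) \<in> parcs G \<and> gdist G u y = 2 * r}"
      using sphere_1[OF ux(2)] adj_verts(2)[of x] by (auto simp: sphere_def)
    ultimately show "card {y. (x, y) \<in> parcs G \<and> gdist G u y = 2 * r} = cA (2 * r + 1)" by simp
  qed
  have R: "edge_relations G A B = rel ` colours" using edge_relations_eq assms(4,5) by simp
  have scheme: "association_scheme (edges G) (edge_relations G A B)" using edge_scheme(1) R by simp
  have "cmat.dim (cmat.span (adj_matrix ` edge_relations G A B)) = card (edge_relations G A B)"
  proof (rule dim_span_adj_matrix)
    show "finite (edge_relations G A B)" by (simp add: R colours_def)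
  qed (use scheme in \<open>auto simp: association_scheme_def partition_on_def\<close>)
  also have "\<dots> = 2 * d - 1" using card_colours edge_scheme(2) assms(5) by (simp add: R card_image)
  finally show ?thesis using scheme assms(10) by (simp add: adjacency_algebra_def)
qed

end
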